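(* Let $D_{16}$ be the exceptional bounded symmetric domain of dimension $16$, i.e. the open unit ball of $M_{1,2}(\mathbb{O})$ in its spectral norm. Then its squeezing constant is $\hat\sigma_{D_{16}}=1/\sqrt2$.
   Context: $\mathbb{O}$ is the complex Cayley algebra (complexified octonions, $\dim_{\mathbb{C}}\mathbb{O}=8$). $H_3(\mathbb{O})$ is the $27$-dimensional complex space of $3\times3$ matrices over $\mathbb{O}$ hermitian with respect to the canonical ($\mathbb{C}$-linear) involution of $\mathbb{O}$; it is a Jordan algebra with $x\cdot y=\frac12(xy+yx)$ and a JB*-triple with triple product $\{x,y,z\}=(x\cdot y^* )\cdot z+x\cdot(y^*\cdot z)-y^*\cdot(x\cdot z)$, where $y\mapsto y^*$ is complex conjugation of the entries. $M_{1,2}(\mathbb{O})$, the $16$-dimensional space of $1\times2$ matrices over $\mathbb{O}$, is identified with a subtriple of $H_3(\mathbb{O})$ (a subspace closed under the triple product): $(a,b)$ corresponds to the hermitian matrix with $(1,2)$-entry $a$, $(1,3)$-entry $b$, the corresponding conjugate entries in positions $(2,1)$, $(3,1)$, and zeros elsewhere. It is thereby a JB*-triple of rank $2$. A tripotent in $V=M_{1,2}(\mathbb{O})$ is an element $e$ with $\{e,e,e\}=e$; a nonzero tripotent is minimal if $\{e,V,e\}=\mathbb{C}e$. Elements $a,b\in V$ are (triple) orthogonal if $\{a,b,x\}=0$ for all $x\in V$. Every $z\in V$ has a spectral decomposition $z=\alpha_1e_1+\alpha_2e_2$ with mutually orthogonal minimal tripotents $e_1,e_2$ of $V$ and $\alpha_1\ge\alpha_2\ge0$;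 the spectral norm is $\|z\|=\alpha_1$ (the JB*-triple norm). $D_{16}=\{z\in M_{1,2}(\mathbb{O}):\|z\|<1\}$. **Squeezing constant.** For a Hilbert space $H$, $B_H$ is its open unit ball and $rB_H=\{x\in H:\|x\|<r\}$. For a bounded domain $D$ in a complex Banach space $V$ linearly homeomorphic to $H$, $H(D,B_H)$ denotes the set of holomorphic embeddings of $D$ into $B_H$ (maps biholomorphic onto a domain in $B_H$); put $$\sigma_D(p)=\sup\{r>0:rB_H\subset f(D)\text{ for some }f\in H(D,B_H)\text{ with }f(p)=0\}$$ (independent of the choice of $H$) and $\hat\sigma_D=\inf_{p\in D}\sigma_D(p)$. *)

theory Defs
  imports "HOL-Analysis.Analysis"
begin

section \<open>Finite-dimensional complex Hilbert spaces\<close>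

text \<open>The norm axiom makes multiplication by \<open>\<i>\<close> an isometry of the underlying real
  inner product, so that inner product is the real part of a complex one inducing the same norm.\<close>

class complex_euclidean_space = euclidean_space +
  fixes scaleC :: "complex \<Rightarrow> 'a \<Rightarrow> 'a"  (infixr "*\<^sub>C" 75)
  assumes scaleC_add_right: "a *\<^sub>C (x + y) = a *\<^sub>C x + a *\<^sub>C y"
    and scaleC_add_left: "(a + b) *\<^sub>C x = a *\<^sub>C x + b *\<^sub>C x"
    and scaleC_scaleC: "a *\<^sub>C b *\<^sub>C x = (a * b) *\<^sub>C x"
    and scaleC_of_real: "complex_of_real r *\<^sub>C x = r *\<^sub>R x"
    and norm_scaleC: "norm (a *\<^sub>C x) = norm a * norm x"

instantiation complex :: complex_euclidean_space
begin

definition scaleC_complex :: "complex \<Rightarrow> complex \<Rightarrow> complex"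
  where "scaleC_complex = (*)"

instance
  by standard (simp_all add: scaleC_complex_def algebra_simps scaleR_conv_of_real norm_mult)

end

instantiation prod :: (complex_euclidean_space, complex_euclidean_space) complex_euclidean_space
begin

definition scaleC_prod :: "complex \<Rightarrow> 'a \<times> 'b \<Rightarrow> 'a \<times> 'b"
  where "scaleC_prod c = map_prod (scaleC c) (scaleC c)"

instance
proof
  fix a :: complex and x :: "'a \<times> 'b"
  show "norm (a *\<^sub>C x) = norm a * norm x"
    by (cases x)
       (simp add: scaleC_prod_def norm_Pair norm_scaleC power_mult_distrib
         real_sqrt_mult flip: distrib_left)
qed (auto simp: scaleC_prod_def prod_eq_iff scaleC_add_right scaleC_add_left scaleC_scaleC
       scaleC_of_real)

end


section \<open>Holomorphic maps and the squeezing constant\<close>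

text \<open>Meant for open \<open>S\<close>.\<close>

definition holo_on ::
  "('a::complex_euclidean_space \<Rightarrow> 'b::complex_euclidean_space) \<Rightarrow> 'a set \<Rightarrow> bool"
  where "holo_on f S \<longleftrightarrow>
    (\<forall>x\<in>S. \<exists>f'. (f has_derivative f') (at x) \<and> (\<forall>c v. f' (c *\<^sub>C v) = c *\<^sub>C f' v))"

definition holo_embedding ::
  "('a::complex_euclidean_space \<Rightarrow> 'b::complex_euclidean_space) \<Rightarrow> 'a set \<Rightarrow> 'b set \<Rightarrow> bool"
  where "holo_embedding f D B \<longleftrightarrow>
    holo_on f D \<and> f ` D \<subseteq> B \<and> open (f ` D) \<and> connected (f ` D) \<and>
    (\<exists>g. holo_on g (f ` D) \<and> (\<forall>x\<in>D. g (f x) = x))"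

text \<open>The Hilbert space \<open>H\<close> into whose unit ball \<open>D\<close> is embedded is the ambient type \<open>'a\<close> with
  its Euclidean norm.  A different norm that may be used to define \<open>D\<close> plays no role here.\<close>

definition squeezing :: "'a::complex_euclidean_space set \<Rightarrow> 'a \<Rightarrow> real"
  where "squeezing D p =
    Sup {r. r > 0 \<and> (\<exists>f :: 'a \<Rightarrow> 'a. holo_embedding f D (ball 0 1) \<and> f p = 0 \<and> ball 0 r \<subseteq> f ` D)}"

definition squeezing_constant :: "'a::complex_euclidean_space set \<Rightarrow> real"
  where "squeezing_constant D = (INF p\<in>D. squeezing D p)"


section \<open>The complex Cayley algebra\<close>

text \<open>Cayley--Dickson doubling of an algebra with product \<open>m\<close> and involution \<open>j\<close>.  Starting from
  the complex numbers with the \<^emph>\<open>trivial\<close> involution, three doublings give the complexification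
  of the real octonions with its complex linear canonical involution.\<close>

definition cd_mult :: "('a::ab_group_add \<Rightarrow> 'a \<Rightarrow> 'a) \<Rightarrow> ('a \<Rightarrow> 'a) \<Rightarrow> 'a \<times> 'a \<Rightarrow> 'a \<times> 'a \<Rightarrow> 'a \<times> 'a"
  where "cd_mult m j x y = (case x of (a, b) \<Rightarrow> case y of (c, d) \<Rightarrow>
    (m a c - m (j d) b, m d a + m b (j c)))"

definition cd_conj :: "('a::ab_group_add \<Rightarrow> 'a) \<Rightarrow> 'a \<times> 'a \<Rightarrow> 'a \<times> 'a"
  where "cd_conj j x = (case x of (a, b) \<Rightarrow> (j a, - b))"

type_synonym 'a dbl = "'a \<times> 'a"
type_synonym oct = "complex dbl dbl dbl"

definition oconj :: "oct \<Rightarrow> oct"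
  where "oconj = cd_conj (cd_conj (cd_conj id))"

definition omult :: "oct \<Rightarrow> oct \<Rightarrow> oct"  (infixl "\<odot>" 70)
  where "omult =
    cd_mult (cd_mult (cd_mult (*) id) (cd_conj id)) (cd_conj (cd_conj id))"

text \<open>Complex conjugation with respect to the real octonions; not to be confused with \<open>oconj\<close>.\<close>

definition ocnj :: "oct \<Rightarrow> oct"
  where "ocnj = map_prod (map_prod (map_prod cnj cnj) (map_prod cnj cnj))
    (map_prod (map_prod cnj cnj) (map_prod cnj cnj))"


section \<open>The Jordan triple of hermitian matrices\<close>

definition H3 :: "(oct^3^3) set"
  where "H3 = {x. \<forall>i j. oconj (x $ j $ i) = x $ i $ j}"

definition mmult :: "oct^3^3 \<Rightarrow> oct^3^3 \<Rightarrow> oct^3^3"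
  where "mmult x y = (\<chi> i j. \<Sum>k\<in>UNIV. x $ i $ k \<odot> y $ k $ j)"

definition jordan :: "oct^3^3 \<Rightarrow> oct^3^3 \<Rightarrow> oct^3^3"  (infixl "\<bullet>\<^sub>J" 70)
  where "x \<bullet>\<^sub>J y = (1/2) *\<^sub>R (mmult x y + mmult y x)"

definition mstar :: "oct^3^3 \<Rightarrow> oct^3^3"
  where "mstar y = (\<chi> i j. ocnj (y $ i $ j))"

definition jtriple :: "oct^3^3 \<Rightarrow> oct^3^3 \<Rightarrow> oct^3^3 \<Rightarrow> oct^3^3"
  where "jtriple x y z =
    (x \<bullet>\<^sub>J mstar y) \<bullet>\<^sub>J z + x \<bullet>\<^sub>J (mstar y \<bullet>\<^sub>J z) - mstar y \<bullet>\<^sub>J (x \<bullet>\<^sub>J z)"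


section \<open>The subtriple of \<open>1 \<times> 2\<close> matrices\<close>

type_synonym m12 = "oct \<times> oct"

definition emb :: "m12 \<Rightarrow> oct^3^3"
  where "emb x = (case x of (a, b) \<Rightarrow>
    vector [vector [0, a, b], vector [oconj a, 0, 0], vector [oconj b, 0, 0]])"

text \<open>The triple product read off from the first row; that it is the restriction of the product
  of \<open>H3\<close> along \<open>emb\<close> is \<open>emb_triple\<close> below.\<close>

definition triple :: "m12 \<Rightarrow> m12 \<Rightarrow> m12 \<Rightarrow> m12"
  where "triple x y z =
    (let t = jtriple (emb x) (emb y) (emb z) in (t $ 1 $ 2, t $ 1 $ 3))"

locale involutive_algebra =
  fixes m :: "'a::real_vector \<Rightarrow> 'a \<Rightarrow> 'a" and j :: "'a \<Rightarrow> 'a"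
  assumes m_add_left: "m (x + y) z = m x z + m y z"
    and m_add_right: "m x (y + z) = m x y + m x z"
    and m_scaleR_left: "m (r *\<^sub>R x) y = r *\<^sub>R m x y"
    and m_scaleR_right: "m x (r *\<^sub>R y) = r *\<^sub>R m x y"
    and j_add: "j (x + y) = j x + j y"
    and j_scaleR: "j (r *\<^sub>R x) = r *\<^sub>R j x"
    and j_j: "j (j x) = x"
    and j_m: "j (m x y) = m (j y) (j x)"
begin

lemma m_minus_left: "m (- x) y = - m x y"
  using m_scaleR_left[of "-1" x y] by simp

lemma m_minus_right: "m x (- y) = - m x y"
  using m_scaleR_right[of x "-1" y] by simp

lemma j_minus: "j (- x) = - j x"
  using j_scaleR[of "-1" x] by simp

lemma j_diff: "j (x - y) = j x - j y"
  using j_add[of x "- y"] by (simp add: j_minus)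

lemma m_zero: "m 0 x = 0" "m x 0 = 0"
  using m_scaleR_left[of 0 0 x] m_scaleR_right[of x 0 0] by simp_all

lemma j_zero: "j 0 = 0"
  using j_scaleR[of 0 0] by simp

end

lemma involutive_algebra_cd:
  assumes "involutive_algebra m j"
  shows "involutive_algebra (cd_mult m j) (cd_conj j)"
proof -
  interpret involutive_algebra m j
    by (rule assms)
  show ?thesis
    by unfold_locales
       (simp_all add: cd_mult_def cd_conj_def split_beta m_add_left m_add_right m_scaleR_left
         m_scaleR_right m_minus_left m_minus_right j_add j_scaleR j_j j_m j_minus j_diff
         scaleR_add_right scaleR_diff_right)
qed

interpretation oct: involutive_algebra omult oconj
  unfolding omult_def oconj_def
  by (intro involutive_algebra_cd, unfold_locales) (simp_all add: algebra_simps)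

lemmas [simp] = oct.m_zero oct.j_zero

lemma ocnj_zero [simp]: "ocnj 0 = 0"
  by (simp add: ocnj_def zero_prod_def)

lemma ocnj_oconj: "ocnj (oconj x) = oconj (ocnj x)"
  by (simp add: oconj_def ocnj_def cd_conj_def split_beta prod_eq_iff)

lemma H3_jordan:
  assumes "x \<in> H3" "y \<in> H3"
  shows "x \<bullet>\<^sub>J y \<in> H3"
proof -
  have x: "oconj (x $ i $ j) = x $ j $ i" and y: "oconj (y $ i $ j) = y $ j $ i" for i j
    using assms by (simp_all add: H3_def)
  show ?thesis
    by (simp add: H3_def jordan_def mmult_def sum_3 oct.j_add oct.j_scaleR oct.j_m x y add_ac)
qed

lemma H3_mstar: "x \<in> H3 \<Longrightarrow> mstar x \<in> H3"
  by (simp add: H3_def mstar_def flip: ocnj_oconj)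

lemma H3_jtriple: "x \<in> H3 \<Longrightarrow> y \<in> H3 \<Longrightarrow> z \<in> H3 \<Longrightarrow> jtriple x y z \<in> H3"
proof -
  have "u + v - w \<in> H3" if "u \<in> H3" "v \<in> H3" "w \<in> H3" for u v w
    using that by (simp add: H3_def oct.j_add oct.j_diff)
  then show "x \<in> H3 \<Longrightarrow> y \<in> H3 \<Longrightarrow> z \<in> H3 \<Longrightarrow> jtriple x y z \<in> H3"
    unfolding jtriple_def by (simp add: H3_jordan H3_mstar)
qed

lemma emb_in_H3: "emb x \<in> H3"
  by (cases x) (simp add: H3_def emb_def forall_3 oct.j_j)

lemma emb_triple: "emb (triple x y z) = jtriple (emb x) (emb y) (emb z)"
proof -
  define V where "V = {M :: oct^3^3. M $ 1 $ 1 = 0 \<and> M $ 2 $ 2 = 0 \<and> M $ 2 $ 3 = 0 \<and>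
    M $ 3 $ 2 = 0 \<and> M $ 3 $ 3 = 0}"
  define P where "P = {M :: oct^3^3. M $ 1 $ 2 = 0 \<and> M $ 1 $ 3 = 0 \<and> M $ 2 $ 1 = 0 \<and>
    M $ 3 $ 1 = 0}"
  have VV: "u \<bullet>\<^sub>J v \<in> P" if "u \<in> V" "v \<in> V" for u v
    using that by (simp add: V_def P_def jordan_def mmult_def sum_3)
  have PV: "u \<bullet>\<^sub>J v \<in> V" "v \<bullet>\<^sub>J u \<in> V" if "u \<in> P" "v \<in> V" for u v
    using that by (simp_all add: V_def P_def jordan_def mmult_def sum_3)
  have add: "u + v - w \<in> V" if "u \<in> V" "v \<in> V" "w \<in> V" for u v w
    using that by (simp add: V_def)
  have star: "mstar u \<in> V" if "u \<in> V" for u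
    using that by (simp add: V_def mstar_def)
  have emb: "emb u \<in> V" for u
    by (cases u) (simp add: V_def emb_def)
  define t where "t = jtriple (emb x) (emb y) (emb z)"
  have "t \<in> V"
    unfolding t_def jtriple_def by (intro add VV PV star emb)
  have "t \<in> H3"
    unfolding t_def by (intro H3_jtriple emb_in_H3)
  have h: "t $ 2 $ 1 = oconj (t $ 1 $ 2)" "t $ 3 $ 1 = oconj (t $ 1 $ 3)"
    using \<open>t \<in> H3\<close> by (auto simp: H3_def)
  have "emb (t $ 1 $ 2, t $ 1 $ 3) = t"
    using \<open>t \<in> V\<close> by (simp add: vec_eq_iff forall_3 emb_def V_def h)
  then show ?thesis
    by (simp add: triple_def Let_def t_def)
qed


section \<open>Spectral norm and the domain\<close>

definition tripotent :: "m12 \<Rightarrow> bool"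
  where "tripotent e \<longleftrightarrow> triple e e e = e"

definition minimal_tripotent :: "m12 \<Rightarrow> bool"
  where "minimal_tripotent e \<longleftrightarrow>
    tripotent e \<and> e \<noteq> 0 \<and> range (\<lambda>v. triple e v e) = range (\<lambda>c. c *\<^sub>C e)"

definition orthogonal_triple :: "m12 \<Rightarrow> m12 \<Rightarrow> bool"
  where "orthogonal_triple a b \<longleftrightarrow> (\<forall>x. triple a b x = 0)"

definition spectral_decomp :: "m12 \<Rightarrow> real \<Rightarrow> m12 \<Rightarrow> real \<Rightarrow> m12 \<Rightarrow> bool"
  where "spectral_decomp z \<alpha>\<^sub>1 e\<^sub>1 \<alpha>\<^sub>2 e\<^sub>2 \<longleftrightarrow>
    minimal_tripotent e\<^sub>1 \<and> minimal_tripotent e\<^sub>2 \<and> orthogonal_triple e\<^sub>1 e\<^sub>2 \<and>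
    \<alpha>\<^sub>1 \<ge> \<alpha>\<^sub>2 \<and> \<alpha>\<^sub>2 \<ge> 0 \<and> z = \<alpha>\<^sub>1 *\<^sub>R e\<^sub>1 + \<alpha>\<^sub>2 *\<^sub>R e\<^sub>2"

text \<open>Every element has a spectral decomposition, and its largest coefficient is unique.\<close>

definition spectral_norm :: "m12 \<Rightarrow> real"
  where "spectral_norm z = (THE \<alpha>. \<exists>e\<^sub>1 \<beta> e\<^sub>2. spectral_decomp z \<alpha> e\<^sub>1 \<beta> e\<^sub>2)"

definition D16 :: "m12 set"
  where "D16 = {z. spectral_norm z < 1}"

end

theory Submission
  imports Defs "HOL-Complex_Analysis.Conformal_Mappings"
begin

text \<open>The argument rests on the fact that pairs of complex octonions form the half-spin representation
  of \<open>Spin(10)\<close>.  In suitable linear coordinates an element is \<open>z = (x, y, w)\<close> with \<open>x\<close> a number, \<open>y\<close> an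
  antisymmetric \<open>5 \<times> 5\<close> matrix and \<open>w\<close> a vector of length \<open>5\<close>; the ten quadratic forms \<open>x w + Pf(y)\<close> and
  \<open>y w\<close>, whose common zeros are the pure spinors, make up a vector \<open>q(z)\<close>.  With the hermitian form
  \<open>herm\<close>, which is twice the standard one, and the polarisation of \<open>q\<close>, the Jordan triple product is
  \<open>\<langle>{u,v,z}, z'\<rangle> = (\<langle>u,v\<rangle>\<langle>z,z'\<rangle> + \<langle>z,v\<rangle>\<langle>u,z'\<rangle>) / 2 - 2 \<langle>q(u,z), q(v,z')\<rangle>\<close>  (lemma \<open>herm_triple\<close>).
  Everything about the triple product is read off from the two forms in this identity.

  The minimal tripotents are the \<open>f\<close> with \<open>\<langle>f,f\<rangle> = 1\<close> and \<open>q(f) = 0\<close>.  If \<open>z = a f + b g\<close> with \<open>f\<close>, \<open>g\<close> orthogonal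
  minimal tripotents, then \<open>\<langle>z,z\<rangle> = a\<^sup>2 + b\<^sup>2\<close> and \<open>|q(z)|\<^sup>2 = a\<^sup>2 b\<^sup>2\<close>.  So \<open>a \<ge> b \<ge> 0\<close> are determined by \<open>z\<close>, the
  generic norm \<open>1 - \<langle>z,z\<rangle> + |q(z)|\<^sup>2\<close> equals \<open>(1 - a\<^sup>2) (1 - b\<^sup>2)\<close>, and the domain is the part of the open
  Euclidean unit ball on which the generic norm is positive (lemma \<open>D16_iff\<close>).  Such a decomposition
  exists because the maximum of \<open>|x|\<close> on the closure of the orbit of \<open>z\<close>, under the linear maps that
  preserve both forms, can only be attained where \<open>y = 0\<close>, and there it is visible.

  Lower bound.  In the Euclidean norm the domain lies in the unit ball and contains the ball of
  radius \<open>1 / \<surd>2\<close>, which settles points close to \<open>0\<close>.  A general point is brought close to \<open>0\<close> by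
  automorphisms of the domain: an explicit Moebius transformation in the direction of \<open>x\<close> multiplies the
  generic norm by \<open>1 / (1 - |x|\<^sup>2)\<close> at a point with first coordinate \<open>x\<close>, so the generic norm attains its
  maximum on the closure of an orbit only at \<open>0\<close> (lemma \<open>orbit_accumulates_at_0\<close>).

  Upper bound, at the point \<open>0\<close>.  Let \<open>L\<close> be the derivative at \<open>0\<close> of an embedding \<open>f\<close> into the unit ball
  with \<open>f(0) = 0\<close> whose image contains the ball of radius \<open>r\<close>, and let \<open>e\<^sub>1\<close>, \<open>e\<^sub>2\<close> be orthogonal minimal
  tripotents.  The Schwarz lemma for \<open>f\<close> on the discs through \<open>e\<^sub>1 + e\<^sub>2\<close> and \<open>e\<^sub>1 - e\<^sub>2\<close> gives
  \<open>\<parallel>L e\<^sub>1 \<plusminus> L e\<^sub>2\<parallel> \<le> 1\<close>, and for the inverse of \<open>f\<close> it gives \<open>\<parallel>L e\<^sub>i\<parallel> \<ge> r\<close>.  The parallelogram law then yields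
  \<open>4 r\<^sup>2 \<le> 2\<close>.\<close>

declare One_nat_def [simp del] split_paired_All [simp del] split_paired_Ex [simp del]

section \<open>Index arithmetic modulo five\<close>

definition cyclic :: "'a \<Rightarrow> 'a \<Rightarrow> 'a \<Rightarrow> 'a \<Rightarrow> 'a \<Rightarrow> 5 \<Rightarrow> 'a" where
  "cyclic a0 a1 a2 a3 a4 i =
    (if i = 0 then a0 else if i = 1 then a1 else if i = 2 then a2 else if i = 3 then a3 else a4)"

lemma cyclic_simps [simp]:
  "cyclic a0 a1 a2 a3 a4 0 = a0" "cyclic a0 a1 a2 a3 a4 1 = a1" "cyclic a0 a1 a2 a3 a4 2 = a2"
  "cyclic a0 a1 a2 a3 a4 3 = a3" "cyclic a0 a1 a2 a3 a4 4 = a4"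
  by (simp_all add: cyclic_def)

lemma UNIV_5: "(UNIV :: 5 set) = {0, 1, 2, 3, 4}"
proof -
  have "card {0 :: 5, 1, 2, 3, 4} = CARD(5)"
    by simp
  then have "{0 :: 5, 1, 2, 3, 4} = UNIV"
    by (intro card_subset_eq) simp_all
  then show ?thesis ..
qed

lemma sum_5: "(\<Sum>i\<in>(UNIV :: 5 set). f i) = f 0 + f 1 + f 2 + f 3 + f 4"
  unfolding UNIV_5 by (simp add: add_ac)

lemma forall_5: "(\<forall>i :: 5. P i) \<longleftrightarrow> P 0 \<and> P 1 \<and> P 2 \<and> P 3 \<and> P 4"
proof -
  have "(\<forall>i :: 5. P i) \<longleftrightarrow> (\<forall>i \<in> {0, 1, 2, 3, 4}. P i)"
    unfolding UNIV_5[symmetric] by simp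
  then show ?thesis by simp
qed

lemma mod_5 [simp]: "(5 :: 5) = 0" "(6 :: 5) = 1" "(7 :: 5) = 2" "(8 :: 5) = 3" "(9 :: 5) = 4"
  "(10 :: 5) = 0" "(11 :: 5) = 1" "(12 :: 5) = 2" "(13 :: 5) = 3" "(14 :: 5) = 4"
  "(15 :: 5) = 0" "(16 :: 5) = 1" "(17 :: 5) = 2" "(18 :: 5) = 3" "(19 :: 5) = 4"
  "(20 :: 5) = 0" "(21 :: 5) = 1" "(24 :: 5) = 4"
  by simp_all

section \<open>Null coordinates of the Cayley algebra\<close>

text \<open>The eight null coordinates \<open>a\<^sub>2\<^sub>k \<plusminus> \<i> a\<^sub>2\<^sub>k\<^sub>+\<^sub>1\<close>.  They diagonalise the first doubling of the
  Cayley--Dickson process, so that every coordinate of an octonion product is a signed sum of only four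
  monomials.\<close>

definition pc :: "nat \<Rightarrow> oct \<Rightarrow> complex" where
  "pc k a = (case a of (((a0, a1), (a2, a3)), ((a4, a5), (a6, a7))) \<Rightarrow>
    [a0 + \<i> * a1, a0 - \<i> * a1, a2 + \<i> * a3, a2 - \<i> * a3,
     a4 + \<i> * a5, a4 - \<i> * a5, a6 + \<i> * a7, a6 - \<i> * a7] ! k)"

lemma pc_omult:
  "pc 0 (a \<odot> b) = pc 0 a * pc 0 b - pc 2 a * pc 3 b - pc 4 a * pc 5 b - pc 7 a * pc 6 b"
  "pc 1 (a \<odot> b) = pc 1 a * pc 1 b - pc 3 a * pc 2 b - pc 5 a * pc 4 b - pc 6 a * pc 7 b"
  "pc 2 (a \<odot> b) = pc 0 a * pc 2 b + pc 2 a * pc 1 b + pc 5 a * pc 6 b - pc 6 a * pc 5 b"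
  "pc 3 (a \<odot> b) = pc 1 a * pc 3 b + pc 3 a * pc 0 b + pc 4 a * pc 7 b - pc 7 a * pc 4 b"
  "pc 4 (a \<odot> b) = pc 0 a * pc 4 b - pc 3 a * pc 6 b + pc 4 a * pc 1 b + pc 6 a * pc 3 b"
  "pc 5 (a \<odot> b) = pc 1 a * pc 5 b - pc 2 a * pc 7 b + pc 5 a * pc 0 b + pc 7 a * pc 2 b"
  "pc 6 (a \<odot> b) = pc 1 a * pc 6 b + pc 2 a * pc 4 b - pc 4 a * pc 2 b + pc 6 a * pc 0 b"
  "pc 7 (a \<odot> b) = pc 0 a * pc 7 b + pc 3 a * pc 5 b - pc 5 a * pc 3 b + pc 7 a * pc 1 b"
  by (cases a; cases b; simp add: pc_def omult_def cd_mult_def cd_conj_def split_beta algebra_simps)+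

lemma pc_oconj:
  "pc 0 (oconj a) = pc 1 a" "pc 1 (oconj a) = pc 0 a"
  "pc 2 (oconj a) = - pc 2 a" "pc 3 (oconj a) = - pc 3 a" "pc 4 (oconj a) = - pc 4 a"
  "pc 5 (oconj a) = - pc 5 a" "pc 6 (oconj a) = - pc 6 a" "pc 7 (oconj a) = - pc 7 a"
  by (simp_all add: pc_def oconj_def cd_conj_def split_beta)

lemma pc_ocnj:
  "pc 0 (ocnj a) = cnj (pc 1 a)" "pc 1 (ocnj a) = cnj (pc 0 a)"
  "pc 2 (ocnj a) = cnj (pc 3 a)" "pc 3 (ocnj a) = cnj (pc 2 a)"
  "pc 4 (ocnj a) = cnj (pc 5 a)" "pc 5 (ocnj a) = cnj (pc 4 a)"
  "pc 6 (ocnj a) = cnj (pc 7 a)" "pc 7 (ocnj a) = cnj (pc 6 a)"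
  by (simp_all add: pc_def ocnj_def split_beta)

lemma pc_linear:
  assumes "k < 8"
  shows "pc k (a + b) = pc k a + pc k b" "pc k (a - b) = pc k a - pc k b"
    "pc k (r *\<^sub>R a) = of_real r * pc k a" "pc k (c *\<^sub>C a) = c * pc k a"
  using assms
  by (auto simp: pc_def split_beta numeral_eq_Suc less_Suc_eq scaleC_prod_def scaleC_complex_def algebra_simps scaleR_conv_of_real)

section \<open>Spinor coordinates and the pure spinor quadrics\<close>

text \<open>The null coordinates of the two octonions, renamed and with signs, as the coordinates of a half
  spinor: \<open>X\<close> is the scalar, \<open>U z i\<close> and \<open>V z i\<close> are the entries \<open>(i, i + 1)\<close> and \<open>(i, i + 2)\<close> of the
  antisymmetric matrix, indices modulo \<open>5\<close>, and \<open>W\<close> is the vector.  For \<open>z = (a, b)\<close>, the norms of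
  \<open>a\<close> and \<open>b\<close> and the eight null coordinates of \<open>oconj a \<odot> b\<close> then become, up to sign and order, the ten
  values \<open>q1 z z i\<close>, \<open>q2 z z i\<close> below, which a cyclic shift of the indices permutes.\<close>

definition X :: "m12 \<Rightarrow> complex" where
  "X z = pc 0 (fst z)"

definition U :: "m12 \<Rightarrow> 5 \<Rightarrow> complex" where
  "U z = cyclic (pc 2 (fst z)) (pc 4 (fst z)) (pc 3 (fst z)) (pc 7 (snd z)) (pc 2 (snd z))"

definition V :: "m12 \<Rightarrow> 5 \<Rightarrow> complex" where
  "V z = cyclic (- pc 6 (fst z)) (pc 7 (fst z)) (pc 4 (snd z)) (- pc 5 (fst z)) (- pc 0 (snd z))"

definition W :: "m12 \<Rightarrow> 5 \<Rightarrow> complex" where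
  "W z = cyclic (- pc 3 (snd z)) (pc 1 (snd z)) (pc 5 (snd z)) (pc 6 (snd z)) (pc 1 (fst z))"

definition herm :: "m12 \<Rightarrow> m12 \<Rightarrow> complex" where
  "herm z w = X z * cnj (X w) +
    (\<Sum>i\<in>UNIV. U z i * cnj (U w i) + V z i * cnj (V w i) + W z i * cnj (W w i))"

text \<open>Polarised forms: on the diagonal, \<open>q1 z z\<close> is \<open>x w + Pf(y)\<close> with the \<open>4 \<times> 4\<close> Pfaffians of \<open>y\<close>, and
  \<open>q2 z z\<close> is the product of the matrix \<open>y\<close> with \<open>w\<close>.\<close>

definition q1 :: "m12 \<Rightarrow> m12 \<Rightarrow> 5 \<Rightarrow> complex" where
  "q1 z w i = (X z * W w i + X w * W z i
    + U z (i + 1) * U w (i + 3) + U w (i + 1) * U z (i + 3)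
    - V z (i + 1) * V w (i + 2) - V w (i + 1) * V z (i + 2)
    - V z (i + 4) * U w (i + 2) - V w (i + 4) * U z (i + 2)) / 2"

definition q2 :: "m12 \<Rightarrow> m12 \<Rightarrow> 5 \<Rightarrow> complex" where
  "q2 z w i = (U z i * W w (i + 1) + U w i * W z (i + 1)
    + V z i * W w (i + 2) + V w i * W z (i + 2)
    - V z (i + 3) * W w (i + 3) - V w (i + 3) * W z (i + 3)
    - U z (i + 4) * W w (i + 4) - U w (i + 4) * W z (i + 4)) / 2"

definition q_herm :: "m12 \<Rightarrow> m12 \<Rightarrow> m12 \<Rightarrow> m12 \<Rightarrow> complex" where
  "q_herm x z y w = (\<Sum>i\<in>UNIV. q1 x z i * cnj (q1 y w i) + q2 x z i * cnj (q2 y w i))"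

section \<open>The triple product in spinor coordinates\<close>

text \<open>Twice the entries \<open>(1, 1)\<close>, \<open>(2, 2)\<close> and \<open>(2, 3)\<close> of the Jordan product of two matrices in the image of
  \<open>emb\<close>; the entries \<open>(3, 3)\<close> and \<open>(3, 2)\<close> arise by exchanging the components of the pairs.\<close>

definition j11 where "j11 x y = (case x of (a, b) \<Rightarrow> case y of (c, d) \<Rightarrow>
   a \<odot> oconj c + b \<odot> oconj d + c \<odot> oconj a + d \<odot> oconj b)"
definition j22 where "j22 a c = oconj a \<odot> c + oconj c \<odot> a"
definition j23 where "j23 a b c d = oconj a \<odot> d + oconj c \<odot> b"

text \<open>Four times the entries \<open>(1, 2)\<close> and \<open>(1, 3)\<close> of \<open>(x \<bullet> y) \<bullet> z\<close>, where \<open>\<bullet>\<close> is the Jordan product of the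
  matrices of \<open>x\<close>, \<open>y\<close>, \<open>z\<close>.\<close>

definition row_product :: "m12 \<Rightarrow> m12 \<Rightarrow> m12 \<Rightarrow> m12" where
  "row_product x y z = (case x of (a, b) \<Rightarrow> case y of (c, d) \<Rightarrow> case z of (e, f) \<Rightarrow>
    (j11 (a,b) (c,d) \<odot> e + e \<odot> j22 a c + f \<odot> j23 b a d c,
     j11 (a,b) (c,d) \<odot> f + e \<odot> j23 a b c d + f \<odot> j22 b d))"

lemma jordan_emb_row:
  "((emb x \<bullet>\<^sub>J emb y) \<bullet>\<^sub>J emb z) $ 1 $ 2 = (1/4) *\<^sub>R fst (row_product x y z)"
  "((emb x \<bullet>\<^sub>J emb y) \<bullet>\<^sub>J emb z) $ 1 $ 3 = (1/4) *\<^sub>R snd (row_product x y z)"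
  by (simp_all add: jordan_def mmult_def sum_3 emb_def split_beta row_product_def j11_def j22_def j23_def
      oct.m_add_left oct.m_add_right oct.m_scaleR_left oct.m_scaleR_right
      scaleR_add_right)

lemma jordan_commute: "x \<bullet>\<^sub>J y = y \<bullet>\<^sub>J x"
  by (simp add: jordan_def add.commute)

lemma mstar_emb: "mstar (emb x) = emb (map_prod ocnj ocnj x)"
  by (simp add: mstar_def emb_def split_beta vec_eq_iff forall_3 ocnj_oconj)

lemma triple_row_product:
  fixes x y z :: m12
  defines "y' \<equiv> map_prod ocnj ocnj y"
  shows "fst (triple x y z) = (1/4) *\<^sub>R (fst (row_product x y' z) + fst (row_product y' z x) - fst (row_product x z y'))"
    and "snd (triple x y z) = (1/4) *\<^sub>R (snd (row_product x y' z) + snd (row_product y' z x) - snd (row_product x z y'))"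
  unfolding triple_def jtriple_def Let_def mstar_emb y'_def[symmetric]
  by (simp_all only: jordan_commute[of "emb x" "emb y' \<bullet>\<^sub>J emb z"] jordan_commute[of "emb y'" "emb x \<bullet>\<^sub>J emb z"]
     vector_add_component vector_minus_component jordan_emb_row fst_conv snd_conv
     scaleR_add_right scaleR_diff_right)

lemmas coord_defs = X_def U_def V_def W_def

text \<open>Twice the bilinear form that polarises the octonion norm.\<close>

definition null_pairing :: "oct \<Rightarrow> oct \<Rightarrow> complex" where
  "null_pairing a b = pc 0 a * pc 1 b + pc 1 a * pc 0 b + pc 2 a * pc 3 b + pc 3 a * pc 2 b
     + pc 4 a * pc 5 b + pc 5 a * pc 4 b + pc 6 a * pc 7 b + pc 7 a * pc 6 b"

text \<open>The sums \<open>a c' + c a'\<close>, with \<open>oconj\<close> written as a dash, are scalars by polarisation of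
  \<open>a a' = n(a)\<close>.  Replacing them by scalars leaves one octonionic product in each entry of
  \<open>row_product\<close> and keeps the expansion of the triple product short.\<close>

lemma pc_j11:
  "pc 0 (j11 x y) = null_pairing (fst x) (fst y) + null_pairing (snd x) (snd y)"
  "pc 1 (j11 x y) = null_pairing (fst x) (fst y) + null_pairing (snd x) (snd y)"
  "pc 2 (j11 x y) = 0" "pc 3 (j11 x y) = 0" "pc 4 (j11 x y) = 0"
  "pc 5 (j11 x y) = 0" "pc 6 (j11 x y) = 0" "pc 7 (j11 x y) = 0"
  by (simp_all add: j11_def split_beta null_pairing_def pc_linear pc_omult pc_oconj algebra_simps)

lemma pc_j22:
  "pc 0 (j22 a c) = null_pairing a c" "pc 1 (j22 a c) = null_pairing a c"
  "pc 2 (j22 a c) = 0" "pc 3 (j22 a c) = 0" "pc 4 (j22 a c) = 0"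
  "pc 5 (j22 a c) = 0" "pc 6 (j22 a c) = 0" "pc 7 (j22 a c) = 0"
  by (simp_all add: j22_def split_beta null_pairing_def pc_linear pc_omult pc_oconj algebra_simps)

lemma pc_scalar_mult:
  assumes "pc 0 s = c" "pc 1 s = c" "pc 2 s = 0" "pc 3 s = 0" "pc 4 s = 0"
     "pc 5 s = 0" "pc 6 s = 0" "pc 7 s = 0" "k < 8"
  shows "pc k (s \<odot> a) = c * pc k a" "pc k (a \<odot> s) = c * pc k a"
proof -
  have "k = 0 \<or> k = 1 \<or> k = 2 \<or> k = 3 \<or> k = 4 \<or> k = 5 \<or> k = 6 \<or> k = 7"
    using assms(9) by arith
  then show "pc k (s \<odot> a) = c * pc k a" "pc k (a \<odot> s) = c * pc k a"
    by (elim disjE; simp add: pc_omult assms)+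
qed

lemma pc_row_product:
  assumes "k < 8"
  shows "pc k (fst (row_product x y z)) = (2 * null_pairing (fst x) (fst y) + null_pairing (snd x) (snd y)) * pc k (fst z)
      + pc k (snd z \<odot> j23 (snd x) (fst x) (snd y) (fst y))"
   "pc k (snd (row_product x y z)) = (null_pairing (fst x) (fst y) + 2 * null_pairing (snd x) (snd y)) * pc k (snd z)
      + pc k (fst z \<odot> j23 (fst x) (snd x) (fst y) (snd y))"
  using assms by (simp_all add: row_product_def split_beta pc_linear pc_scalar_mult[OF pc_j11] pc_scalar_mult[OF pc_j22]
    distrib_right)

lemmas pc_triple = triple_row_product pc_linear pc_row_product

lemmas pc_expand = null_pairing_def pc_ocnj pc_omult pc_linear pc_oconj j23_def herm_def q1_def q2_def
  sum_5 coord_defs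

text \<open>The subtracted term pairs \<open>q(x, z)\<close> with the partial derivatives at \<open>y\<close> of the ten quadratic forms in
  the coordinate on the left-hand side; so it does for the other three families of coordinates.\<close>

lemma triple_X:
  "X (triple x y z) = (herm x y * X z + herm z y * X x) / 2 - (\<Sum>i\<in>UNIV. q1 x z i * cnj (W y i))"
  by (simp add: coord_defs pc_triple, simp add: pc_expand, simp add: field_simps)

lemma triple_U:
  "U (triple x y z) i = (herm x y * U z i + herm z y * U x i) / 2
    - (q1 x z (i + 4) * cnj (U y (i + 2)) + q1 x z (i + 2) * cnj (U y (i + 3))
       - q1 x z (i + 3) * cnj (V y (i + 2))
       + q2 x z i * cnj (W y (i + 1)) - q2 x z (i + 1) * cnj (W y i))"
  (is "?l i = ?r i")
proof -
  have "\<forall>i. ?l i = ?r i"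
    unfolding forall_5
    by (intro conjI; simp add: coord_defs pc_triple, simp add: pc_expand, simp add: field_simps)
  then show ?thesis ..
qed

lemma triple_V:
  "V (triple x y z) i = (herm x y * V z i + herm z y * V x i) / 2
    - (- q1 x z (i + 4) * cnj (V y (i + 1)) - q1 x z (i + 3) * cnj (V y (i + 4))
       - q1 x z (i + 1) * cnj (U y (i + 3))
       + q2 x z i * cnj (W y (i + 2)) - q2 x z (i + 2) * cnj (W y i))"
  (is "?l i = ?r i")
proof -
  have "\<forall>i. ?l i = ?r i"
    unfolding forall_5
    by (intro conjI; simp add: coord_defs pc_triple, simp add: pc_expand, simp add: field_simps)
  then show ?thesis ..
qed

lemma triple_W:
  "W (triple x y z) i = (herm x y * W z i + herm z y * W x i) / 2
    - (q1 x z i * cnj (X y) + q2 x z (i + 4) * cnj (U y (i + 4))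
       + q2 x z (i + 3) * cnj (V y (i + 3))
       - q2 x z (i + 2) * cnj (V y i) - q2 x z (i + 1) * cnj (U y i))"
  (is "?l i = ?r i")
proof -
  have "\<forall>i. ?l i = ?r i"
    unfolding forall_5
    by (intro conjI; simp add: coord_defs pc_triple, simp add: pc_expand, simp add: field_simps)
  then show ?thesis ..
qed

lemma cyc_sum:
  fixes f :: "5 \<Rightarrow> complex"
  shows "(\<Sum>i\<in>UNIV. f (i + k)) = (\<Sum>i\<in>UNIV. f i)"
  by (rule sum.reindex_bij_witness[of _ "\<lambda>i. i - k" "\<lambda>i. i + k"]) auto

text \<open>The sum of the coordinate formulas: contracting the partial derivatives of a quadratic form at \<open>y\<close> with
  \<open>w\<close> gives twice its polarisation.  All later statements about \<open>triple\<close> are deduced from this identity.\<close>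

lemma herm_triple:
  "herm (triple x y z) w =
    (herm x y * herm z w + herm z y * herm x w) / 2 - 2 * q_herm x z y w"
proof -
  define a b where "a = q1 x z" and "b = q2 x z"
  define r s where "r = herm x y" and "s = herm z y"
  show ?thesis
    unfolding herm_def[of _ w] triple_X triple_U triple_V triple_W q_herm_def
    unfolding a_def[symmetric] b_def[symmetric] r_def[symmetric] s_def[symmetric]
    by (simp add: sum_5 q1_def q2_def, simp add: field_simps)
qed

section \<open>Linearity and hermitian structure\<close>

lemma coord_add [simp]:
  "X (z + w) = X z + X w" "U (z + w) i = U z i + U w i"
  "V (z + w) i = V z i + V w i" "W (z + w) i = W z i + W w i"
  by (simp_all add: coord_defs cyclic_def pc_linear)

lemma coord_diff [simp]:
  "X (z - w) = X z - X w" "U (z - w) i = U z i - U w i"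
  "V (z - w) i = V z i - V w i" "W (z - w) i = W z i - W w i"
  by (simp_all add: coord_defs cyclic_def pc_linear)

lemma fst_scaleC [simp]: "fst (c *\<^sub>C z) = c *\<^sub>C fst z"
  and snd_scaleC [simp]: "snd (c *\<^sub>C z) = c *\<^sub>C snd z"
  by (simp_all add: scaleC_prod_def)

lemma coord_scaleC [simp]:
  "X (c *\<^sub>C z) = c * X z" "U (c *\<^sub>C z) i = c * U z i"
  "V (c *\<^sub>C z) i = c * V z i" "W (c *\<^sub>C z) i = c * W z i"
  by (simp_all add: coord_defs cyclic_def pc_linear)

lemma coord_scaleR [simp]:
  "X (r *\<^sub>R z) = of_real r * X z" "U (r *\<^sub>R z) i = of_real r * U z i"
  "V (r *\<^sub>R z) i = of_real r * V z i" "W (r *\<^sub>R z) i = of_real r * W z i"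
  by (simp_all flip: scaleC_of_real)

lemma coord_zero [simp]: "X 0 = 0" "U 0 i = 0" "V 0 i = 0" "W 0 i = 0"
  using coord_scaleR[of 0 0] by simp_all

text \<open>Inverse of the eight functions \<open>pc\<close>.\<close>

definition of_null_coords :: "complex \<Rightarrow> complex \<Rightarrow> complex \<Rightarrow> complex \<Rightarrow> complex \<Rightarrow> complex \<Rightarrow> complex \<Rightarrow> complex \<Rightarrow> oct" where
  "of_null_coords p0 p1 p2 p3 p4 p5 p6 p7 =
    ((((p0 + p1) / 2, (p0 - p1) / (2 * \<i>)), ((p2 + p3) / 2, (p2 - p3) / (2 * \<i>))),
     (((p4 + p5) / 2, (p4 - p5) / (2 * \<i>)), ((p6 + p7) / 2, (p6 - p7) / (2 * \<i>))))"

definition of_coords :: "complex \<Rightarrow> (5 \<Rightarrow> complex) \<Rightarrow> (5 \<Rightarrow> complex) \<Rightarrow> (5 \<Rightarrow> complex) \<Rightarrow> m12" where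
  "of_coords x u v w = (of_null_coords x (w 4) (u 0) (u 2) (u 1) (- v 3) (- v 0) (v 1),
     of_null_coords (- v 4) (w 1) (u 4) (- w 0) (v 2) (w 2) (w 3) (u 3))"

lemma pc_of_pc [simp]:
  "pc 0 (of_null_coords p0 p1 p2 p3 p4 p5 p6 p7) = p0" "pc 1 (of_null_coords p0 p1 p2 p3 p4 p5 p6 p7) = p1"
  "pc 2 (of_null_coords p0 p1 p2 p3 p4 p5 p6 p7) = p2" "pc 3 (of_null_coords p0 p1 p2 p3 p4 p5 p6 p7) = p3"
  "pc 4 (of_null_coords p0 p1 p2 p3 p4 p5 p6 p7) = p4" "pc 5 (of_null_coords p0 p1 p2 p3 p4 p5 p6 p7) = p5"
  "pc 6 (of_null_coords p0 p1 p2 p3 p4 p5 p6 p7) = p6" "pc 7 (of_null_coords p0 p1 p2 p3 p4 p5 p6 p7) = p7"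
  by (simp_all add: of_null_coords_def pc_def field_simps)

lemma of_pc_pc: "of_null_coords (pc 0 a) (pc 1 a) (pc 2 a) (pc 3 a) (pc 4 a) (pc 5 a) (pc 6 a) (pc 7 a) = a"
  by (simp add: of_null_coords_def pc_def split_beta prod_eq_iff field_simps)

lemma coord_of_coords [simp]:
  "X (of_coords x u v w) = x" "U (of_coords x u v w) = u" "V (of_coords x u v w) = v" "W (of_coords x u v w) = w"
proof -
  show "X (of_coords x u v w) = x"
    by (simp add: of_coords_def X_def)
  have "\<forall>i. U (of_coords x u v w) i = u i" "\<forall>i. V (of_coords x u v w) i = v i" "\<forall>i. W (of_coords x u v w) i = w i"
    unfolding forall_5 by (simp_all add: of_coords_def coord_defs)
  then show "U (of_coords x u v w) = u" "V (of_coords x u v w) = v" "W (of_coords x u v w) = w"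
    by auto
qed

lemma of_coords_coords: "of_coords (X z) (U z) (V z) (W z) = z"
  by (simp add: of_coords_def coord_defs of_pc_pc)

lemma coord_eqI:
  assumes "X z = X w" "\<And>i. U z i = U w i" "\<And>i. V z i = V w i" "\<And>i. W z i = W w i"
  shows "z = w"
proof -
  have "U z = U w" "V z = V w" "W z = W w"
    using assms by auto
  then show ?thesis
    using assms(1) by (metis of_coords_coords)
qed

lemma herm_add_left: "herm (x + y) z = herm x z + herm y z"
  and herm_add_right: "herm x (y + z) = herm x y + herm x z"
  and herm_diff_left: "herm (x - y) z = herm x z - herm y z"
  and herm_scaleC_left: "herm (c *\<^sub>C x) z = c * herm x z"
  and herm_scaleC_right: "herm x (c *\<^sub>C z) = cnj c * herm x z"
  and herm_cnj: "cnj (herm x y) = herm y x"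
  by (simp_all add: herm_def ring_distribs sum.distrib sum_subtractf sum_distrib_left mult_ac)

lemma herm_scaleR [simp]: "herm (r *\<^sub>R x) z = of_real r * herm x z"
   "herm x (r *\<^sub>R z) = of_real r * herm x z"
  by (simp_all add: herm_scaleC_left herm_scaleC_right flip: scaleC_of_real)

lemma herm_zero [simp]: "herm 0 z = 0" "herm z 0 = 0"
  by (simp_all add: herm_def)

text \<open>The factor \<open>2\<close> arises because the two null coordinates of a pair satisfy
  \<open>|p\<^sub>+|\<^sup>2 + |p\<^sub>-|\<^sup>2 = 2 (|a\<^sub>2\<^sub>k|\<^sup>2 + |a\<^sub>2\<^sub>k\<^sub>+\<^sub>1|\<^sup>2)\<close>.  It makes minimal tripotents unit vectors for
  \<open>herm\<close>, of Euclidean norm \<open>1 / \<surd>2\<close>.\<close>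

lemma Re_herm: "Re (herm z w) = 2 * (z \<bullet> w)"
  by (simp add: herm_def sum_5 coord_defs pc_def split_beta inner_prod_def inner_complex_def, simp add: algebra_simps)

lemma herm_self: "herm z z = of_real (2 * (norm z)\<^sup>2)"
  by (simp add: complex_eq_iff Re_herm power2_norm_eq_inner)
    (metis herm_cnj complex_cnj_cancel_iff Reals_cnj_iff complex_is_Real_iff)

lemma herm_eqI:
  assumes "\<And>w. herm x w = herm y w"
  shows "x = y"
proof -
  have "herm (x - y) (x - y) = 0"
    by (simp add: herm_diff_left assms)
  then show ?thesis
    by (simp add: herm_self)
qed

lemma q_add_left: "q1 (x + y) z i = q1 x z i + q1 y z i" "q2 (x + y) z i = q2 x z i + q2 y z i"
  and q_scaleC_left: "q1 (c *\<^sub>C x) z i = c * q1 x z i" "q2 (c *\<^sub>C x) z i = c * q2 x z i"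
  and q_commute: "q1 x z i = q1 z x i" "q2 x z i = q2 z x i"
  by (simp_all add: q1_def q2_def field_simps)

lemma q_add_right: "q1 z (x + y) i = q1 z x i + q1 z y i" "q2 z (x + y) i = q2 z x i + q2 z y i"
  and q_scaleC_right: "q1 z (c *\<^sub>C x) i = c * q1 z x i" "q2 z (c *\<^sub>C x) i = c * q2 z x i"
  by (simp_all only: q_commute[of z] q_add_left q_scaleC_left)

lemma q_scaleR: "q1 (r *\<^sub>R x) z i = r * q1 x z i" "q2 (r *\<^sub>R x) z i = r * q2 x z i"
  "q1 z (r *\<^sub>R x) i = r * q1 z x i" "q2 z (r *\<^sub>R x) i = r * q2 z x i"
  by (simp_all add: q_scaleC_left q_scaleC_right flip: scaleC_of_real)

text \<open>The generic norm of the Jordan triple, evaluated at \<open>(z, z)\<close>.\<close>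

definition generic_norm :: "m12 \<Rightarrow> real" where
  "generic_norm z = 1 - 2 * (norm z)\<^sup>2 + (\<Sum>i\<in>UNIV. (cmod (q1 z z i))\<^sup>2 + (cmod (q2 z z i))\<^sup>2)"

lemma hq_self: "q_herm z z z z = of_real (\<Sum>i\<in>UNIV. (cmod (q1 z z i))\<^sup>2 + (cmod (q2 z z i))\<^sup>2)"
  by (simp add: q_herm_def of_real_sum of_real_add complex_norm_square flip: of_real_power)

lemma hq_self_0_iff: "q_herm z z z z = 0 \<longleftrightarrow> (\<forall>i. q1 z z i = 0 \<and> q2 z z i = 0)"
  unfolding hq_self
  by (simp only: of_real_eq_0_iff, subst sum_nonneg_eq_0_iff) (auto simp: add_nonneg_eq_0_iff)

lemma hq_cnj: "cnj (q_herm x z y w) = q_herm y w x z"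
  by (simp add: q_herm_def mult.commute)

lemma hq_commute: "q_herm x z y w = q_herm z x y w" "q_herm x z y w = q_herm x z w y"
  by (simp_all add: q_herm_def q_commute[of x] q_commute[of y])

lemma X_linear: "linear X" and U_linear: "linear (\<lambda>z. U z i)" and V_linear: "linear (\<lambda>z. V z i)" and W_linear: "linear (\<lambda>z. W z i)"
  by (simp_all add: linear_iff scaleR_conv_of_real)

lemma coord_continuous [continuous_intros]:
  assumes "continuous_on S f"
  shows "continuous_on S (\<lambda>x. X (f x))" "continuous_on S (\<lambda>x. U (f x) i)"
    "continuous_on S (\<lambda>x. V (f x) i)" "continuous_on S (\<lambda>x. W (f x) i)"
proof -
  have *: "continuous_on S (\<lambda>x. g (f x))" if "linear g" for g :: "m12 \<Rightarrow> complex"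
    using continuous_on_compose[OF assms linear_continuous_on] that
    by (simp add: o_def linear_conv_bounded_linear)
  show "continuous_on S (\<lambda>x. X (f x))" by (rule *[OF X_linear])
  show "continuous_on S (\<lambda>x. U (f x) i)" by (rule *[OF U_linear])
  show "continuous_on S (\<lambda>x. V (f x) i)" by (rule *[OF V_linear])
  show "continuous_on S (\<lambda>x. W (f x) i)" by (rule *[OF W_linear])
qed

lemma herm_continuous [continuous_intros]:
  assumes "continuous_on S f" "continuous_on S g"
  shows "continuous_on S (\<lambda>x. herm (f x) (g x))"
  unfolding herm_def by (intro continuous_intros assms)

lemma q_continuous [continuous_intros]:
  assumes "continuous_on S f" "continuous_on S g"
  shows "continuous_on S (\<lambda>x. q1 (f x) (g x) i)" "continuous_on S (\<lambda>x. q2 (f x) (g x) i)"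
  unfolding q1_def q2_def by (intro continuous_intros assms; simp)+

lemma hq_continuous [continuous_intros]:
  assumes "continuous_on S f" "continuous_on S g" "continuous_on S h" "continuous_on S k"
  shows "continuous_on S (\<lambda>x. q_herm (f x) (g x) (h x) (k x))"
  unfolding q_herm_def by (intro continuous_intros assms)

lemma generic_norm_continuous [continuous_intros]:
  assumes "continuous_on S f"
  shows "continuous_on S (\<lambda>x. generic_norm (f x))"
  unfolding generic_norm_def by (intro continuous_intros assms)

section \<open>Linear maps preserving the two forms\<close>

text \<open>These maps form the group \<open>U(1) Spin(10)\<close>.  Only the values of the forms are recorded, since by
  \<open>herm_triple\<close> they determine the triple product.\<close>

definition spin_map :: "(m12 \<Rightarrow> m12) \<Rightarrow> bool" where
  "spin_map k \<longleftrightarrow> linear k \<and> (\<forall>c z. k (c *\<^sub>C z) = c *\<^sub>C k z) \<and>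
    (\<forall>z w. herm (k z) (k w) = herm z w) \<and>
    (\<forall>x z y w. q_herm (k x) (k z) (k y) (k w) = q_herm x z y w)"

lemma spin_mapD:
  assumes "spin_map k"
  shows "linear k" "k (c *\<^sub>C z) = c *\<^sub>C k z" "herm (k z) (k w) = herm z w"
    "q_herm (k x) (k z) (k y) (k w) = q_herm x z y w"
  using assms unfolding spin_map_def by blast+

lemma spin_map_norm:
  assumes "spin_map k"
  shows "norm (k z) = norm z"
  using spin_mapD(3)[OF assms, of z z] unfolding herm_self of_real_eq_iff by simp

lemma generic_norm_q_herm: "of_real (generic_norm z) = 1 - herm z z + q_herm z z z z"
  by (simp add: generic_norm_def herm_self hq_self)

lemma spin_map_generic_norm:
  assumes "spin_map k"
  shows "generic_norm (k z) = generic_norm z"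
proof -
  have "of_real (generic_norm (k z)) = (of_real (generic_norm z) :: complex)"
    by (simp add: generic_norm_q_herm spin_mapD[OF assms])
  then show ?thesis
    unfolding of_real_eq_iff .
qed

lemma spin_map_id: "spin_map (\<lambda>z. z)"
  by (simp add: spin_map_def linear_iff)

lemma spin_map_compose:
  assumes "spin_map k" "spin_map l"
  shows "spin_map (\<lambda>z. k (l z))"
  using assms linear_compose[of l k] unfolding spin_map_def o_def by simp

lemma spin_map_inverse:
  assumes "spin_map k"
  obtains l where "spin_map l" "\<And>z. l (k z) = z" "\<And>z. k (l z) = z"
proof -
  have lin: "linear k"
    using assms by (rule spin_mapD)
  have "inj k"
    unfolding linear_injective_0[OF lin]
  proof (intro allI impI)
    fix z assume "k z = 0"
    then show "z = 0"
      using spin_map_norm[OF assms, of z] by simp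
  qed
  then obtain l where l: "linear l" "\<And>z. l (k z) = z" "\<And>z. k (l z) = z"
    using linear_injective_isomorphism[OF lin] by metis
  have "spin_map l"
    unfolding spin_map_def
  proof (intro conjI allI)
    show "linear l" by fact
    fix c z show "l (c *\<^sub>C z) = c *\<^sub>C l z"
      using l(2)[of "c *\<^sub>C l z"] by (simp add: spin_mapD[OF assms] l(3))
  next
    fix z w show "herm (l z) (l w) = herm z w"
      using spin_mapD(3)[OF assms, of "l z" "l w"] by (simp add: l(3))
  next
    fix x z y w show "q_herm (l x) (l z) (l y) (l w) = q_herm x z y w"
      using spin_mapD(4)[OF assms, of "l x" "l z" "l y" "l w"] by (simp add: l(3))
  qed
  with l show ?thesis
    by (intro that)
qed

lemma spin_mapI:
  assumes "\<And>x y. k (x + y) = k x + k y" "\<And>c z. k (c *\<^sub>C z) = c *\<^sub>C k z"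
    "\<And>z w. herm (k z) (k w) = herm z w"
    "\<And>x z y w. q_herm (k x) (k z) (k y) (k w) = q_herm x z y w"
  shows "spin_map k"
  using assms unfolding spin_map_def linear_iff by (simp flip: scaleC_of_real)

text \<open>Permuting the five indices cyclically.\<close>

definition cyclic_shift :: "5 \<Rightarrow> m12 \<Rightarrow> m12" where
  "cyclic_shift k z = of_coords (X z) (\<lambda>i. U z (i + k)) (\<lambda>i. V z (i + k)) (\<lambda>i. W z (i + k))"

lemma spin_map_cyclic_shift: "spin_map (cyclic_shift k)"
proof (rule spin_mapI)
  show "cyclic_shift k (x + y) = cyclic_shift k x + cyclic_shift k y" for x y
    by (rule coord_eqI) (simp_all add: cyclic_shift_def)
  show "cyclic_shift k (c *\<^sub>C z) = c *\<^sub>C cyclic_shift k z" for c z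
    by (rule coord_eqI) (simp_all add: cyclic_shift_def)
  show "herm (cyclic_shift k z) (cyclic_shift k w) = herm z w" for z w
    unfolding herm_def cyclic_shift_def coord_of_coords by (subst cyc_sum) simp
  have q: "q1 (cyclic_shift k x) (cyclic_shift k z) i = q1 x z (i + k)"
    "q2 (cyclic_shift k x) (cyclic_shift k z) i = q2 x z (i + k)" for x z i
    by (simp_all add: q1_def q2_def cyclic_shift_def add_ac)
  show "q_herm (cyclic_shift k x) (cyclic_shift k z) (cyclic_shift k y) (cyclic_shift k w) = q_herm x z y w" for x z y w
    unfolding q_herm_def q by (rule cyc_sum)
qed

text \<open>The index permutation \<open>i \<mapsto> 2 i\<close> modulo \<open>5\<close>, whose inverse is multiplication by \<open>3\<close>; it interchanges
  the two families of matrix entries.  It is an odd permutation, so the Pfaffians change sign, which is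
  compensated by the sign of \<open>W\<close>.\<close>

definition index_double :: "m12 \<Rightarrow> m12" where
  "index_double z = of_coords (X z) (\<lambda>i. - V z (3 * i + 3)) (\<lambda>i. U z (3 * i)) (\<lambda>i. - W z (3 * i))"

lemma spin_map_index_double: "spin_map index_double"
proof (rule spin_mapI)
  show "index_double (x + y) = index_double x + index_double y" for x y
    by (rule coord_eqI) (simp_all add: index_double_def)
  show "index_double (c *\<^sub>C z) = c *\<^sub>C index_double z" for c z
    by (rule coord_eqI) (simp_all add: index_double_def)
  show "herm (index_double z) (index_double w) = herm z w" for z w
    by (simp add: herm_def index_double_def sum_5)
  have "\<forall>i. q1 (index_double x) (index_double z) i = - q1 x z (3 * i) \<and> q2 (index_double x) (index_double z) i = - q2 x z (3 * i)" for x z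
    unfolding forall_5 by (simp add: q1_def q2_def index_double_def field_simps)
  then have q: "q1 (index_double x) (index_double z) i = - q1 x z (3 * i)" "q2 (index_double x) (index_double z) i = - q2 x z (3 * i)" for x z i
    by auto
  show "q_herm (index_double x) (index_double z) (index_double y) (index_double w) = q_herm x z y w" for x z y w
    by (simp add: q_herm_def q sum_5)
qed

text \<open>Elements of the \<open>SU(2)\<close> that belongs to the root joining the weight of \<open>X\<close> to that of the matrix entry
  \<open>(0, 1)\<close>.  They rotate the four pairs of coordinates whose weights differ by this root and fix the
  other eight.\<close>

definition root_rotation :: "real \<Rightarrow> complex \<Rightarrow> m12 \<Rightarrow> m12" where
  "root_rotation c s z = of_coords (c * X z + s * U z 0)
     (\<lambda>i. if i = 0 then c * U z 0 - cnj s * X z else if i = 2 then c * U z 2 - s * W z 4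
          else if i = 3 then c * U z 3 - s * W z 2 else U z i)
     (\<lambda>i. if i = 2 then c * V z 2 + s * W z 3 else V z i)
     (\<lambda>i. if i = 2 then c * W z 2 + cnj s * U z 3 else if i = 3 then c * W z 3 - cnj s * V z 2
          else if i = 4 then c * W z 4 + cnj s * U z 2 else W z i)"

lemma rotation_unitary:
  fixes a b a' b' s :: complex and c :: real
  assumes "c\<^sup>2 + (cmod s)\<^sup>2 = 1"
  shows "(c * a + s * b) * cnj (c * a' + s * b') + (c * b - cnj s * a) * cnj (c * b' - cnj s * a')
    = a * cnj a' + b * cnj b'"
proof -
  have "complex_of_real c * c + s * cnj s = 1"
    using assms by (metis complex_norm_square of_real_1 of_real_add of_real_mult power2_eq_square)
  then have "(complex_of_real c * c + s * cnj s) * (a * cnj a' + b * cnj b') = a * cnj a' + b * cnj b'"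
    by simp
  then show ?thesis
    by (simp add: algebra_simps)
qed

lemma spin_map_root_rotation:
  assumes "c\<^sup>2 + (cmod s)\<^sup>2 = 1"
  shows "spin_map (root_rotation c s)"
proof (rule spin_mapI)
  have s: "c\<^sup>2 + (cmod (- s))\<^sup>2 = 1"
    using assms by simp
  define p where "p t a b a' b' = (c * a + t * b) * cnj (c * a' + t * b')
    + (c * b - cnj t * a) * cnj (c * b' - cnj t * a')" for t a b a' b' :: complex
  have p: "p s a b a' b' = a * cnj a' + b * cnj b'" "p (- s) a b a' b' = a * cnj a' + b * cnj b'" for a b a' b'
    unfolding p_def by (rule rotation_unitary[OF assms], rule rotation_unitary[OF s])
  show "root_rotation c s (x + y) = root_rotation c s x + root_rotation c s y" for x y
    by (rule coord_eqI) (simp_all add: root_rotation_def algebra_simps)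
  show "root_rotation c s (k *\<^sub>C z) = k *\<^sub>C root_rotation c s z" for k z
    by (rule coord_eqI) (simp_all add: root_rotation_def algebra_simps)
  show "herm (root_rotation c s z) (root_rotation c s w) = herm z w" for z w
  proof -
    have "herm (root_rotation c s z) (root_rotation c s w) =
      p s (X z) (U z 0) (X w) (U w 0) + p s (V z 2) (W z 3) (V w 2) (W w 3)
      + p (- s) (U z 3) (W z 2) (U w 3) (W w 2) + p (- s) (U z 2) (W z 4) (U w 2) (W w 4)
      + (U z 1 * cnj (U w 1) + U z 4 * cnj (U w 4) + V z 0 * cnj (V w 0) + V z 1 * cnj (V w 1)
        + V z 3 * cnj (V w 3) + V z 4 * cnj (V w 4) + W z 0 * cnj (W w 0) + W z 1 * cnj (W w 1))"
      unfolding p_def by (simp add: herm_def root_rotation_def sum_5)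
    also have "\<dots> = herm z w"
      unfolding p by (simp add: herm_def sum_5)
    finally show ?thesis .
  qed
  have q: "q1 (root_rotation c s x) (root_rotation c s z) 0 = c * q1 x z 0 - s * q2 x z 1"
    "q2 (root_rotation c s x) (root_rotation c s z) 1 = c * q2 x z 1 + cnj s * q1 x z 0"
    "q1 (root_rotation c s x) (root_rotation c s z) 1 = c * q1 x z 1 + s * q2 x z 0"
    "q2 (root_rotation c s x) (root_rotation c s z) 0 = c * q2 x z 0 - cnj s * q1 x z 1" for x z
    by (simp_all add: q1_def q2_def root_rotation_def field_simps)
  have cs: "complex_of_real c * c + s * cnj s = 1"
    using assms by (metis complex_norm_square of_real_1 of_real_add of_real_mult power2_eq_square)
  have q': "q1 (root_rotation c s x) (root_rotation c s z) 2 = q1 x z 2" "q1 (root_rotation c s x) (root_rotation c s z) 3 = q1 x z 3"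
    "q1 (root_rotation c s x) (root_rotation c s z) 4 = q1 x z 4"
    "q2 (root_rotation c s x) (root_rotation c s z) 2 = q2 x z 2" "q2 (root_rotation c s x) (root_rotation c s z) 3 = q2 x z 3"
    "q2 (root_rotation c s x) (root_rotation c s z) 4 = q2 x z 4" for x z
    by (simp add: q1_def q2_def root_rotation_def, use cs in algebra)+
  show "q_herm (root_rotation c s x) (root_rotation c s z) (root_rotation c s y) (root_rotation c s w) = q_herm x z y w" for x z y w
  proof -
    have "q_herm (root_rotation c s x) (root_rotation c s z) (root_rotation c s y) (root_rotation c s w) =
      p (- s) (q1 x z 0) (q2 x z 1) (q1 y w 0) (q2 y w 1) + p s (q1 x z 1) (q2 x z 0) (q1 y w 1) (q2 y w 0)
      + (q1 x z 2 * cnj (q1 y w 2) + q1 x z 3 * cnj (q1 y w 3) + q1 x z 4 * cnj (q1 y w 4)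
      + q2 x z 2 * cnj (q2 y w 2) + q2 x z 3 * cnj (q2 y w 3) + q2 x z 4 * cnj (q2 y w 4))"
      unfolding p_def by (simp add: q_herm_def sum_5 q q')
    also have "\<dots> = q_herm x z y w"
      unfolding p by (simp add: q_herm_def sum_5)
    finally show ?thesis .
  qed
qed

section \<open>Frames and the existence of spectral decompositions\<close>

text \<open>A root rotation whose axis is adapted to a nonzero matrix entry \<open>u\<close> replaces \<open>|x|\<close> by
  \<open>(|x|\<^sup>2 + |u|\<^sup>2)\<^sup>1\<^sup>/\<^sup>2\<close>; shifts and doubling of the indices carry any matrix entry to the position \<open>(0, 1)\<close>.\<close>

lemma spin_map_grow:
  assumes "U z i \<noteq> 0 \<or> V z i \<noteq> 0"
  obtains k where "spin_map k" "cmod (X z) < cmod (X (k z))"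
proof -
  have base: "\<exists>k. spin_map k \<and> cmod (X z) < cmod (X (k z))" if u: "U z 0 \<noteq> 0" for z
  proof -
    define x u where "x = X z" and "u = U z 0"
    define r where "r = sqrt ((cmod x)\<^sup>2 + (cmod u)\<^sup>2)"
    define t where "t = (if x = 0 then 1 else x / cmod x)"
    \<comment> \<open>Chosen so that \<open>c x + s u = t r\<close>.\<close>
    define c where "c = cmod x / r"
    define s where "s = cnj u * t / r"
    have pos: "(cmod x)\<^sup>2 + (cmod u)\<^sup>2 > 0"
      using u by (simp add: u_def add_nonneg_pos)
    then have r: "r > 0" "r\<^sup>2 = (cmod x)\<^sup>2 + (cmod u)\<^sup>2"
      by (simp_all add: r_def)
    have t: "cmod t = 1" "x = t * cmod x"
      by (simp_all add: t_def norm_divide)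
    have "c\<^sup>2 + (cmod s)\<^sup>2 = ((cmod x)\<^sup>2 + (cmod u)\<^sup>2) / r\<^sup>2"
      using r(1) by (simp add: c_def s_def norm_mult norm_divide t(1) power_divide add_divide_distrib)
    also have "\<dots> = 1"
      unfolding r(2) using pos by (intro divide_self) linarith
    finally have k: "spin_map (root_rotation c s)"
      by (rule spin_map_root_rotation)
    have "c * x = t * (cmod x)\<^sup>2 / r"
      using t(2) by (simp add: c_def power2_eq_square)
    moreover have "s * u = t * (cmod u)\<^sup>2 / r"
      using complex_norm_square[of u] by (simp add: s_def mult_ac)
    ultimately have "X (root_rotation c s z) = t * complex_of_real (r\<^sup>2) / r"
      unfolding r(2) by (simp add: root_rotation_def x_def u_def ring_distribs add_divide_distrib)
    then have "cmod (X (root_rotation c s z)) = r"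
      using r(1) by (simp add: norm_mult norm_divide t(1) power2_eq_square)
    moreover have "cmod x < r"
      unfolding r_def using u by (intro real_less_rsqrt) (simp add: u_def)
    ultimately show ?thesis
      using k by (auto simp: x_def)
  qed
  have baseU: "\<exists>k. spin_map k \<and> cmod (X z) < cmod (X (k z))" if "U z i \<noteq> 0" for z i
  proof -
    have "U (cyclic_shift i z) 0 \<noteq> 0"
      using that by (simp add: cyclic_shift_def)
    then obtain k where "spin_map k" "cmod (X (cyclic_shift i z)) < cmod (X (k (cyclic_shift i z)))"
      using base by blast
    moreover have "X (cyclic_shift i z) = X z"
      by (simp add: cyclic_shift_def)
    ultimately show ?thesis
      using spin_map_compose[OF _ spin_map_cyclic_shift] by metis
  qed
  have "\<exists>k. spin_map k \<and> cmod (X z) < cmod (X (k z))"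
  proof (cases "U z i = 0")
    case True
    with assms have V: "V z i \<noteq> 0"
      by simp
    \<comment> \<open>Doubling moves entry \<open>i\<close> of \<open>V\<close> to entry \<open>2 i + 4\<close> of \<open>U\<close>.\<close>
    have "\<forall>i::5. 3 * (2 * i + 4) + 3 = i"
      unfolding forall_5 by simp
    then have "U (index_double z) (2 * i + 4) \<noteq> 0"
      using V by (simp add: index_double_def)
    then obtain k where "spin_map k" "cmod (X (index_double z)) < cmod (X (k (index_double z)))"
      using baseU by blast
    moreover have "X (index_double z) = X z"
      by (simp add: index_double_def)
    ultimately show ?thesis
      using spin_map_compose[OF _ spin_map_index_double] by metis
  qed (use baseU in blast)
  then show ?thesis
    using that by blast
qed

text \<open>A vector with only \<open>W\<close> coordinates is first turned by a quarter rotation, which moves an entry of \<open>W\<close>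
  into the matrix.\<close>

lemma spin_map_X_nonzero:
  assumes "z \<noteq> 0"
  obtains k where "spin_map k" "X (k z) \<noteq> 0"
proof -
  have UV: "\<exists>k. spin_map k \<and> X (k y) \<noteq> 0" if "U y i \<noteq> 0 \<or> V y i \<noteq> 0" for y i
    using spin_map_grow[OF that] by (metis norm_ge_zero norm_zero not_less)
  consider "X z \<noteq> 0" | i where "U z i \<noteq> 0 \<or> V z i \<noteq> 0" | i where "W z i \<noteq> 0"
    using assms coord_eqI[of z 0] by auto
  then have "\<exists>k. spin_map k \<and> X (k z) \<noteq> 0"
  proof cases
    case 1
    then show ?thesis
      using spin_map_id by blast
  next
    case 2
    then show ?thesis
      by (rule UV)
  next
    case 3
    define l where "l = (\<lambda>z. root_rotation 0 1 (cyclic_shift (i - 2) z))"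
    have "spin_map l"
      unfolding l_def by (rule spin_map_compose[OF spin_map_root_rotation spin_map_cyclic_shift]) simp
    moreover have "U (l z) 3 \<noteq> 0"
      using 3 by (simp add: l_def root_rotation_def cyclic_shift_def)
    then obtain k where "spin_map k" "X (k (l z)) \<noteq> 0"
      using UV by blast
    ultimately show ?thesis
      using spin_map_compose[of k l] by blast
  qed
  then show ?thesis
    using that by blast
qed

definition rank_one :: "m12 \<Rightarrow> bool" where
  "rank_one f \<longleftrightarrow> herm f f = 1 \<and> q_herm f f f f = 0"

text \<open>Two orthogonal minimal tripotents, expressed by the two forms: the last two conditions say that all
  triple products \<open>{f, g, z}\<close> vanish.  In this shape a frame is defined by closed conditions that are
  invariant under the maps above.\<close>

definition frame :: "m12 \<Rightarrow> m12 \<Rightarrow> bool" where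
  "frame f g \<longleftrightarrow> rank_one f \<and> rank_one g \<and> herm f g = 0 \<and>
    (\<forall>z w. herm z g * herm f w = 4 * q_herm f z g w)"

lemma hq_rank_one:
  assumes "rank_one f"
  shows "q_herm f f z w = 0" "q_herm z w f f = 0"
proof -
  have "\<forall>i. q1 f f i = 0 \<and> q2 f f i = 0"
    using assms by (simp add: rank_one_def hq_self_0_iff)
  then show "q_herm f f z w = 0" "q_herm z w f f = 0"
    by (simp_all add: q_herm_def)
qed

lemma frame_sym:
  assumes "frame f g"
  shows "frame g f"
proof -
  have "herm z f * herm g w = 4 * q_herm g z f w" for z w
  proof -
    have "cnj (herm w g * herm f z) = cnj (4 * q_herm f w g z)"
      using assms by (simp add: frame_def)
    then show ?thesis
      by (simp add: herm_cnj hq_cnj mult.commute)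
  qed
  moreover have "herm g f = 0"
    using assms herm_cnj[of f g] by (simp add: frame_def)
  ultimately show ?thesis
    using assms by (simp add: frame_def)
qed

lemma frame_spin_map:
  assumes "spin_map k" "frame f g"
  shows "frame (k f) (k g)"
proof -
  obtain l where l: "\<And>z. k (l z) = z"
    using spin_map_inverse[OF assms(1)] by metis
  have "herm z (k g) * herm (k f) w = 4 * q_herm (k f) z (k g) w" for z w
    using assms(2) spin_mapD(3)[OF assms(1), of "l z" g] spin_mapD(3)[OF assms(1), of f "l w"]
      spin_mapD(4)[OF assms(1), of f "l z" g "l w"]
    by (simp add: l frame_def)
  then show ?thesis
    using assms by (simp add: frame_def rank_one_def spin_mapD)
qed

lemma compact_frames: "compact {p. frame (fst p) (snd p)}"
proof -
  have "closed {p. frame (fst p) (snd p)}"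
    unfolding frame_def rank_one_def
    by (intro closed_Collect_conj closed_Collect_all closed_Collect_eq continuous_intros)
  moreover have "bounded {p. frame (fst p) (snd p)}"
    unfolding bounded_iff
  proof (intro exI ballI)
    fix p assume "p \<in> {p. frame (fst p) (snd p)}"
    then have "herm (fst p) (fst p) = complex_of_real 1" "herm (snd p) (snd p) = complex_of_real 1"
      by (simp_all add: frame_def rank_one_def)
    then have "2 * (norm (fst p))\<^sup>2 = 1" "2 * (norm (snd p))\<^sup>2 = 1"
      unfolding herm_self of_real_eq_iff by simp_all
    then show "norm p \<le> 1"
      by (simp add: norm_prod_def)
  qed
  ultimately show ?thesis
    by (simp add: compact_eq_bounded_closed)
qed

lemma frame_standard:
  assumes "cmod t = 1" "(\<Sum>i\<in>UNIV. (cmod (w i))\<^sup>2) = 1"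
  shows "frame (of_coords t (\<lambda>_. 0) (\<lambda>_. 0) (\<lambda>_. 0)) (of_coords 0 (\<lambda>_. 0) (\<lambda>_. 0) w)"
proof -
  have t: "t * cnj t = 1"
    using assms(1) by (simp flip: complex_norm_square)
  have w: "(\<Sum>i\<in>UNIV. w i * cnj (w i)) = 1"
    using assms(2) by (simp flip: complex_norm_square of_real_power of_real_sum)
  show ?thesis
    unfolding frame_def rank_one_def
    by (simp add: herm_def q_herm_def q1_def q2_def t w sum_distrib_left sum_distrib_right mult_ac)
qed

definition frame_decomp :: "m12 \<Rightarrow> real \<Rightarrow> m12 \<Rightarrow> real \<Rightarrow> m12 \<Rightarrow> bool" where
  "frame_decomp z a f b g \<longleftrightarrow> frame f g \<and> b \<le> a \<and> 0 \<le> b \<and> z = a *\<^sub>R f + b *\<^sub>R g"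

text \<open>When the matrix vanishes, the scalar and the vector part are multiples of an orthogonal pair.\<close>

lemma frame_decomp_standard:
  assumes "\<And>i. U z i = 0" "\<And>i. V z i = 0"
  obtains b f g where "frame f g" "0 \<le> b" "z = cmod (X z) *\<^sub>R f + b *\<^sub>R g"
proof -
  define t where "t = (if X z = 0 then 1 else X z / cmod (X z))"
  have t: "cmod t = 1" "X z = cmod (X z) * t"
    by (simp_all add: t_def norm_divide)
  define b where "b = sqrt (\<Sum>i\<in>UNIV. (cmod (W z i))\<^sup>2)"
  have b: "b \<ge> 0" "b\<^sup>2 = (\<Sum>i\<in>UNIV. (cmod (W z i))\<^sup>2)"
    by (simp_all add: b_def sum_nonneg)
  define w :: "5 \<Rightarrow> complex" where "w = (if b = 0 then (\<lambda>i. if i = 0 then 1 else 0) else (\<lambda>i. W z i / b))"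
  have "(\<Sum>i\<in>UNIV. (cmod (w i))\<^sup>2) = 1"
  proof (cases "b = 0")
    case True
    then show ?thesis
      by (simp add: w_def sum_5)
  next
    case False
    then have "(\<Sum>i\<in>UNIV. (cmod (w i))\<^sup>2) = b\<^sup>2 / b\<^sup>2"
      unfolding b(2) by (simp add: w_def norm_divide power_divide b(2) flip: sum_divide_distrib)
    with False show ?thesis
      by simp
  qed
  note fr = frame_standard[OF t(1) this]
  have W: "W z i = b * w i" for i
  proof (cases "b = 0")
    case True
    then have "(\<Sum>i\<in>UNIV. (cmod (W z i))\<^sup>2) = 0"
      using b(2) by simp
    then have "(cmod (W z i))\<^sup>2 = 0"
      by (subst (asm) sum_nonneg_eq_0_iff) auto
    with True show ?thesis
      by simp
  qed (simp add: w_def)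
  have "z = cmod (X z) *\<^sub>R of_coords t (\<lambda>_. 0) (\<lambda>_. 0) (\<lambda>_. 0) + b *\<^sub>R of_coords 0 (\<lambda>_. 0) (\<lambda>_. 0) w"
    by (rule coord_eqI) (simp_all add: assms W t(2)[symmetric])
  with that[OF fr b(1)] show ?thesis .
qed

text \<open>At a maximum point \<open>m\<close> of \<open>|x|\<close> on the closure of the orbit of \<open>z\<close> the matrix entries vanish, so \<open>m\<close> is
  \<open>a f + b g\<close> for a frame.  Pulling this back gives points \<open>a f' + b g'\<close> arbitrarily close to \<open>z\<close> with the same
  \<open>a\<close> and \<open>b\<close>, and these form a compact set because frames do.  The bound on \<open>|x|\<close> is part of the
  maximality; it later confines the coordinate \<open>x\<close> to the unit disc.\<close>

lemma frame_decomp_exists: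
  obtains a f b g where "frame_decomp z a f b g" "cmod (X z) \<le> a"
proof -
  define S where "S = {k z |k. spin_map k}"
  have "bounded S"
    unfolding bounded_iff S_def by (auto intro!: exI[of _ "norm z"] simp: spin_map_norm)
  then have "compact (closure S)"
    by (simp add: compact_closure)
  moreover have zS: "z \<in> S"
    unfolding S_def using spin_map_id by force
  moreover have "continuous_on (closure S) (\<lambda>z. cmod (X z))"
    by (intro continuous_intros)
  moreover have "closure S \<noteq> {}"
    using zS by auto
  ultimately have "\<exists>m\<in>closure S. \<forall>y\<in>closure S. cmod (X y) \<le> cmod (X m)"
    using continuous_attains_sup by blast
  then obtain m where m: "m \<in> closure S" and max0: "\<forall>y\<in>closure S. cmod (X y) \<le> cmod (X m)"
    by (rule bexE)
  note max = bspec[OF max0]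
  have step: "k m \<in> closure S" if k: "spin_map k" for k
  proof -
    have "k ` S \<subseteq> S"
    proof (rule image_subsetI)
      fix y assume "y \<in> S"
      then obtain l where "spin_map l" "y = l z"
        by (auto simp: S_def)
      then show "k y \<in> S"
        unfolding S_def using spin_map_compose[OF k, of l]
        by (intro CollectI exI[of _ "\<lambda>z. k (l z)"]) simp
    qed
    moreover have "continuous_on (closure S) k"
      using spin_mapD(1)[OF k] by (simp add: linear_continuous_on linear_conv_bounded_linear)
    ultimately have "k ` closure S \<subseteq> closure S"
      by (intro image_closure_subset) (use closure_subset in auto)
    with m show ?thesis
      by blast
  qed
  have "U m i = 0 \<and> V m i = 0" for i
  proof (rule ccontr)
    assume "\<not> (U m i = 0 \<and> V m i = 0)"
    then have "U m i \<noteq> 0 \<or> V m i \<noteq> 0"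
      by blast
    then obtain k where "spin_map k" "cmod (X m) < cmod (X (k m))"
      by (rule spin_map_grow)
    with max[OF step] show False
      by (simp add: not_less[symmetric])
  qed
  then obtain b f g where m_eq: "frame f g" "0 \<le> b" "m = cmod (X m) *\<^sub>R f + b *\<^sub>R g"
    using frame_decomp_standard[of m] by metis
  define a where "a = cmod (X m)"
  define T where "T = (\<lambda>p. a *\<^sub>R fst p + b *\<^sub>R snd p) ` {p. frame (fst p) (snd p)}"
  have "compact T"
    unfolding T_def by (intro compact_continuous_image compact_frames continuous_intros)
  then have "closed T"
    by (rule compact_imp_closed)
  moreover have "z \<in> closure T"
    unfolding closure_approachable
  proof (intro allI impI)
    fix e :: real assume "e > 0"
    then obtain y where "y \<in> S" "dist y m < e"
      using m unfolding closure_approachable by blast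
    then obtain k where k: "spin_map k" "dist (k z) m < e"
      by (auto simp: S_def)
    obtain l where l: "spin_map l" "\<And>z. l (k z) = z"
      using spin_map_inverse[OF k(1)] by metis
    have lin: "linear l"
      by (rule spin_mapD(1)[OF l(1)])
    have "l m = a *\<^sub>R l f + b *\<^sub>R l g"
      by (subst m_eq(3)) (simp add: a_def linear_add[OF lin] linear_scale[OF lin])
    then have "l m \<in> T"
      unfolding T_def using frame_spin_map[OF l(1) m_eq(1)]
      by (intro image_eqI[of _ _ "(l f, l g)"]) simp_all
    moreover have "dist (l m) z < e"
    proof -
      have "l m - z = l (m - k z)"
        by (simp add: linear_diff[OF lin] l(2))
      then show ?thesis
        using k(2) by (simp add: dist_norm spin_map_norm[OF l(1)] norm_minus_commute)
    qed
    ultimately show "\<exists>y\<in>T. dist y z < e"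
      by blast
  qed
  ultimately have "z \<in> T"
    by simp
  then obtain f' g' where fr: "frame f' g'" and z: "z = a *\<^sub>R f' + b *\<^sub>R g'"
    by (auto simp: T_def)
  have a: "cmod (X z) \<le> a"
    unfolding a_def using zS closure_subset by (intro max) blast
  show ?thesis
  proof (cases "b \<le> a")
    case True
    then show ?thesis
      using fr z a m_eq(2) by (intro that[of a f' b g']) (simp_all add: frame_decomp_def)
  next
    case False
    then show ?thesis
      using frame_sym[OF fr] z a m_eq(2)
      by (intro that[of b g' a f']) (simp_all add: frame_decomp_def a_def add.commute)
  qed
qed

section \<open>Minimal tripotents and the spectral norm\<close>

lemma frame_decomp_obtain:
  obtains a f b g where "frame_decomp z a f b g"
  by (rule frame_decomp_exists[of z]) (rule that)

lemma frameD:
  assumes "frame f g"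
  shows "rank_one f" "rank_one g" "herm f g = 0" "herm g f = 0" "herm f f = 1" "herm g g = 1"
    "q_herm f g g w = herm f w / 4" "q_herm f g f w = herm g w / 4"
proof -
  have "4 * q_herm f g g w = herm g g * herm f w" "4 * q_herm g f f w = herm f f * herm g w"
    using assms frame_sym[OF assms] by (simp_all add: frame_def)
  moreover show "rank_one f" "rank_one g" "herm f g = 0" "herm g f = 0" "herm f f = 1" "herm g g = 1"
    using assms frame_sym[OF assms] by (simp_all add: frame_def rank_one_def)
  ultimately have "4 * q_herm f g g w = herm f w" "4 * q_herm f g f w = herm g w"
    by (simp_all add: hq_commute(1)[of f g f])
  then show "q_herm f g g w = herm f w / 4" "q_herm f g f w = herm g w / 4"
    by (simp_all only: nonzero_eq_divide_eq[OF zero_neq_numeral[symmetric]] mult.commute[of _ 4])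
qed

lemma q_frame:
  fixes a b :: real
  assumes "frame f g"
  shows "q1 (a *\<^sub>R f + b *\<^sub>R g) (a *\<^sub>R f + b *\<^sub>R g) i = 2 * a * b * q1 f g i"
    "q2 (a *\<^sub>R f + b *\<^sub>R g) (a *\<^sub>R f + b *\<^sub>R g) i = 2 * a * b * q2 f g i"
proof -
  have "q1 f f i = 0" "q2 f f i = 0" "q1 g g i = 0" "q2 g g i = 0"
    using assms by (simp_all add: frame_def rank_one_def hq_self_0_iff)
  then show "q1 (a *\<^sub>R f + b *\<^sub>R g) (a *\<^sub>R f + b *\<^sub>R g) i = 2 * a * b * q1 f g i"
    "q2 (a *\<^sub>R f + b *\<^sub>R g) (a *\<^sub>R f + b *\<^sub>R g) i = 2 * a * b * q2 f g i"
    by (simp_all add: q_add_left q_add_right q_scaleR q_commute[of g f])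
qed

lemma hq_frame:
  fixes a b :: real
  assumes "frame f g"
  shows "q_herm (a *\<^sub>R f + b *\<^sub>R g) (a *\<^sub>R f + b *\<^sub>R g) y w = 2 * a * b * q_herm f g y w"
  by (simp add: q_herm_def q_frame[OF assms] sum_distrib_left ring_distribs mult.assoc)

lemma hq_add_right: "q_herm x z (y + y') w = q_herm x z y w + q_herm x z y' w"
  and hq_scaleR_right: "q_herm x z (r *\<^sub>R y) w = r * q_herm x z y w"
  by (simp_all add: q_herm_def q_add_left q_scaleR ring_distribs sum.distrib sum_distrib_left mult_ac)

lemma frame_decomp_invariants:
  assumes "frame_decomp z a f b g"
  shows "2 * (norm z)\<^sup>2 = a\<^sup>2 + b\<^sup>2" "generic_norm z = (1 - a\<^sup>2) * (1 - b\<^sup>2)"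
proof -
  have fr: "frame f g" and z: "z = a *\<^sub>R f + b *\<^sub>R g"
    using assms by (simp_all add: frame_decomp_def)
  have h: "herm z z = of_real (a\<^sup>2 + b\<^sup>2)"
    unfolding z by (simp add: herm_add_left herm_add_right frameD[OF fr] power2_eq_square)
  then show n: "2 * (norm z)\<^sup>2 = a\<^sup>2 + b\<^sup>2"
    unfolding herm_self of_real_eq_iff .
  have "q_herm z z z z = of_real (a\<^sup>2 * b\<^sup>2)"
    unfolding z hq_frame[OF fr]
    unfolding hq_add_right hq_scaleR_right frameD(7,8)[OF fr]
    by (simp add: herm_add_right frameD[OF fr] power2_eq_square)
  then have "complex_of_real (generic_norm z) = of_real (1 - (a\<^sup>2 + b\<^sup>2) + a\<^sup>2 * b\<^sup>2)"
    unfolding generic_norm_q_herm h by simp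
  then show "generic_norm z = (1 - a\<^sup>2) * (1 - b\<^sup>2)"
    unfolding of_real_eq_iff by (simp add: algebra_simps)
qed

lemma triple_rank_one:
  assumes "rank_one f"
  shows "triple f v f = herm f v *\<^sub>C f"
  by (rule herm_eqI) (simp add: herm_triple herm_scaleC_left hq_rank_one[OF assms])

lemma rank_one_minimal_tripotent:
  assumes "rank_one f"
  shows "minimal_tripotent f"
proof -
  have f: "herm f f = 1"
    using assms by (simp add: rank_one_def)
  have "tripotent f"
    unfolding tripotent_def by (simp add: triple_rank_one[OF assms] f scaleC_of_real[of 1, simplified])
  moreover have "f \<noteq> 0"
    using f by auto
  moreover have "range (\<lambda>v. triple f v f) = range (\<lambda>c. c *\<^sub>C f)"
  proof (intro equalityI subsetI)
    fix y assume "y \<in> range (\<lambda>c. c *\<^sub>C f)"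
    then obtain c where "y = c *\<^sub>C f"
      by blast
    then have "y = triple f (cnj c *\<^sub>C f) f"
      by (simp add: triple_rank_one[OF assms] herm_scaleC_right f)
    then show "y \<in> range (\<lambda>v. triple f v f)"
      by blast
  qed (use triple_rank_one[OF assms] in auto)
  ultimately show ?thesis
    by (simp add: minimal_tripotent_def)
qed

text \<open>Decompose the tripotent \<open>e\<close> as \<open>a f + b g\<close>.  Since \<open>{e,e,e} = a\<^sup>3 f + b\<^sup>3 g\<close>, both coefficients are \<open>0\<close> or \<open>1\<close>.
  If both were \<open>1\<close>, then \<open>{e,f,e} = f\<close> would be a multiple of \<open>e = f + g\<close>.\<close>

lemma minimal_tripotent_rank_one:
  assumes "minimal_tripotent e"
  shows "rank_one e"
proof -
  have tri: "triple e e e = e" and nz: "e \<noteq> 0" and range: "range (\<lambda>v. triple e v e) = range (\<lambda>c. c *\<^sub>C e)"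
    using assms by (simp_all add: minimal_tripotent_def tripotent_def)
  obtain a f b g where "frame_decomp e a f b g"
    by (rule frame_decomp_obtain)
  then have fr: "frame f g" and ab: "0 \<le> b" "b \<le> a" and e: "e = a *\<^sub>R f + b *\<^sub>R g"
    by (simp_all add: frame_decomp_def)
  have sandwich: "herm (triple e v e) w = herm e v * herm e w - 4 * a * b * q_herm f g v w" for v w
    unfolding herm_triple using hq_frame[OF fr, of a b v w] by (simp add: e)
  have "herm e w = a * herm f w + b * herm g w" for w
    by (simp add: e herm_add_left)
  then have he: "herm e f = a" "herm e g = b" "herm e e = a * herm f e + b * herm g e"
    and hfg: "herm f e = a" "herm g e = b"
    by (simp_all add: frameD[OF fr] e herm_add_right)
  have hqe: "q_herm f g e w = (a * herm g w + b * herm f w) / 4" for w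
    by (simp add: e hq_add_right hq_scaleR_right frameD(7,8)[OF fr] add_divide_distrib)
  have "herm (triple e e e) f = of_real (a ^ 3)" "herm (triple e e e) g = of_real (b ^ 3)"
    unfolding sandwich hqe by (simp_all add: he hfg frameD[OF fr] power3_eq_cube algebra_simps)
  then have "complex_of_real (a ^ 3) = of_real a" "complex_of_real (b ^ 3) = of_real b"
    unfolding tri he by simp_all
  then have "a * (a\<^sup>2 - 1) = 0" "b * (b\<^sup>2 - 1) = 0"
    unfolding of_real_eq_iff by (simp_all add: power2_eq_square power3_eq_cube algebra_simps)
  then have "a = 0 \<or> a = 1" "b = 0 \<or> b = 1"
    using ab by (auto simp: power2_eq_1_iff)
  with ab nz e have a: "a = 1" and b: "b = 0 \<or> b = 1"
    by auto
  have "b \<noteq> 1"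
  proof
    assume b: "b = 1"
    have "triple e f e = f"
    proof (rule herm_eqI)
      fix w
      have "herm e w = herm f w + herm g w"
        by (simp add: e a b herm_add_left)
      then show "herm (triple e f e) w = herm f w"
        unfolding sandwich frameD(8)[OF fr] he by (simp add: a b)
    qed
    then have "f \<in> range (\<lambda>c. c *\<^sub>C e)"
      unfolding range[symmetric] by (metis rangeI)
    then obtain c where c: "f = c *\<^sub>C e"
      by blast
    have "herm f f = c * herm e f" "herm f g = c * herm e g"
      by (subst c, simp add: herm_scaleC_left)+
    then show False
      by (simp add: he a b frameD[OF fr])
  qed
  with a b have "e = f"
    by (simp add: e)
  then show ?thesis
    using frameD(1)[OF fr] by simp
qed

text \<open>Applying \<open>{f,g,\<cdot>}\<close> to \<open>f\<close> itself gives \<open>\<langle>f,g\<rangle> f\<close>, so triple orthogonality forces hermitian orthogonality;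
  then \<open>herm_triple\<close> reduces to the remaining condition of a frame.\<close>

lemma orthogonal_triple_iff_frame:
  assumes "rank_one f" "rank_one g"
  shows "orthogonal_triple f g \<longleftrightarrow> frame f g"
proof
  assume "orthogonal_triple f g"
  then have 0: "triple f g x = 0" for x
    by (simp add: orthogonal_triple_def)
  have "herm (triple f g f) f = herm f g"
    using assms(1) by (simp add: triple_rank_one[OF assms(1)] herm_scaleC_left rank_one_def)
  then have fg: "herm f g = 0"
    by (simp add: 0)
  have "herm z g * herm f w = 4 * q_herm f z g w" for z w
    using herm_triple[of f g z w] by (simp add: 0 fg)
  with fg assms show "frame f g"
    by (simp add: frame_def)
next
  assume "frame f g"
  then have "triple f g x = 0" for x
    by (intro herm_eqI) (simp add: herm_triple frame_def)
  then show "orthogonal_triple f g"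
    by (simp add: orthogonal_triple_def)
qed

lemma spectral_decomp_iff_decomp: "spectral_decomp z a f b g \<longleftrightarrow> frame_decomp z a f b g"
  unfolding spectral_decomp_def frame_decomp_def
proof -
  have "minimal_tripotent f \<longleftrightarrow> rank_one f" "minimal_tripotent g \<longleftrightarrow> rank_one g"
    using minimal_tripotent_rank_one rank_one_minimal_tripotent by blast+
  then show "minimal_tripotent f \<and> minimal_tripotent g \<and> orthogonal_triple f g \<and>
      b \<le> a \<and> 0 \<le> b \<and> z = a *\<^sub>R f + b *\<^sub>R g \<longleftrightarrow>
    frame f g \<and> b \<le> a \<and> 0 \<le> b \<and> z = a *\<^sub>R f + b *\<^sub>R g"
    using orthogonal_triple_iff_frame[of f g] frameD(1,2)[of f g] by auto
qed

text \<open>The sum and the product of \<open>a\<^sup>2\<close> and \<open>b\<^sup>2\<close> are invariants of \<open>z\<close>.\<close>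

lemma frame_decomp_unique:
  assumes "frame_decomp z a f b g" "frame_decomp z a' f' b' g'"
  shows "a = a'"
proof -
  have *: "a = a' \<or> a = b'" if "frame_decomp z a f b g" "frame_decomp z a' f' b' g'" for a f b g a' f' b' g'
  proof -
    have s: "a\<^sup>2 + b\<^sup>2 = a'\<^sup>2 + b'\<^sup>2"
      using frame_decomp_invariants(1)[OF that(1)] frame_decomp_invariants(1)[OF that(2)] by simp
    have p: "(1 - a\<^sup>2) * (1 - b\<^sup>2) = (1 - a'\<^sup>2) * (1 - b'\<^sup>2)"
      using frame_decomp_invariants(2)[OF that(1)] frame_decomp_invariants(2)[OF that(2)] by simp
    have "(a\<^sup>2 - a'\<^sup>2) * (a\<^sup>2 - b'\<^sup>2) = 0"
      using s p by algebra
    then show ?thesis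
      using that by (auto simp: frame_decomp_def power2_eq_iff)
  qed
  show ?thesis
    using *[OF assms] *[OF assms(2,1)] assms by (auto simp: frame_decomp_def)
qed

lemma spectral_norm_decomp:
  assumes "frame_decomp z a f b g"
  shows "spectral_norm z = a"
  unfolding spectral_norm_def spectral_decomp_iff_decomp
  using assms frame_decomp_unique by blast

section \<open>Geometry of the domain\<close>

lemma D16_iff_decomp:
  assumes "frame_decomp z a f b g"
  shows "z \<in> D16 \<longleftrightarrow> a < 1"
  by (simp add: D16_def spectral_norm_decomp[OF assms])

lemma D16_iff: "z \<in> D16 \<longleftrightarrow> 0 < generic_norm z \<and> norm z < 1"
proof -
  obtain a f b g where d: "frame_decomp z a f b g"
    by (rule frame_decomp_obtain)
  then have ab: "0 \<le> b" "b \<le> a"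
    by (simp_all add: frame_decomp_def)
  note inv = frame_decomp_invariants[OF d]
  have norm: "norm z < 1 \<longleftrightarrow> a\<^sup>2 + b\<^sup>2 < 2"
  proof -
    have "norm z < 1 \<longleftrightarrow> (norm z)\<^sup>2 < 1"
      by (simp add: power_less_one_iff)
    then show ?thesis
      using inv(1) by auto
  qed
  have "a < 1 \<longleftrightarrow> 0 < (1 - a\<^sup>2) * (1 - b\<^sup>2) \<and> a\<^sup>2 + b\<^sup>2 < 2"
  proof
    assume "a < 1"
    then have "a\<^sup>2 < 1" "b\<^sup>2 < 1"
      using ab by (simp_all add: power_less_one_iff)
    then show "0 < (1 - a\<^sup>2) * (1 - b\<^sup>2) \<and> a\<^sup>2 + b\<^sup>2 < 2"
      by simp
  next
    assume "0 < (1 - a\<^sup>2) * (1 - b\<^sup>2) \<and> a\<^sup>2 + b\<^sup>2 < 2"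
    then have "a\<^sup>2 < 1"
      by (auto simp: zero_less_mult_iff)
    then show "a < 1"
      using ab by (simp add: power_less_one_iff)
  qed
  then show ?thesis
    unfolding D16_iff_decomp[OF d] inv norm .
qed

text \<open>On the Euclidean unit sphere \<open>a\<^sup>2 + b\<^sup>2 = 2\<close>, so \<open>(1 - a\<^sup>2) (1 - b\<^sup>2) = - (1 - a\<^sup>2)\<^sup>2\<close>.  Hence a path on which the
  generic norm stays positive cannot leave the unit ball.\<close>

lemma generic_norm_nonpos:
  assumes "norm z = 1"
  shows "generic_norm z \<le> 0"
proof -
  obtain a f b g where d: "frame_decomp z a f b g"
    by (rule frame_decomp_obtain)
  have "b\<^sup>2 = 2 - a\<^sup>2"
    using frame_decomp_invariants(1)[OF d] assms by simp
  then have "generic_norm z = - ((1 - a\<^sup>2)\<^sup>2)"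
    unfolding frame_decomp_invariants(2)[OF d] by algebra
  then show ?thesis
    by simp
qed

lemma D16_X:
  assumes "z \<in> D16"
  shows "cmod (X z) < 1"
proof -
  obtain a f b g where "frame_decomp z a f b g" "cmod (X z) \<le> a"
    by (rule frame_decomp_exists)
  with assms show ?thesis
    by (simp add: D16_iff_decomp)
qed

lemma D16_scaleR:
  assumes "z \<in> D16" "0 \<le> r" "r \<le> 1"
  shows "r *\<^sub>R z \<in> D16"
proof -
  obtain a f b g where d: "frame_decomp z a f b g"
    by (rule frame_decomp_obtain)
  then have ab: "frame f g" "0 \<le> b" "b \<le> a" and z: "z = a *\<^sub>R f + b *\<^sub>R g"
    by (simp_all add: frame_decomp_def)
  have "frame_decomp (r *\<^sub>R z) (r * a) f (r * b) g"
    unfolding frame_decomp_def z using ab assms(2) by (simp add: scaleR_add_right mult_left_mono)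
  moreover have "r * a \<le> 1 * a"
    using ab assms(3) by (intro mult_right_mono) simp_all
  ultimately show ?thesis
    using assms(1) D16_iff_decomp[OF d] by (simp add: D16_iff_decomp)
qed

lemma frame_phase:
  assumes "frame f g" "cmod s = 1" "cmod t = 1"
  shows "frame (s *\<^sub>C f) (t *\<^sub>C g)"
proof -
  have st: "cnj s * s = 1" "cnj t * t = 1"
    using assms(2,3) by (simp_all add: mult.commute[of "cnj _"] flip: complex_norm_square)
  have "rank_one (s *\<^sub>C f)" "rank_one (t *\<^sub>C g)"
    using frameD(1,2)[OF assms(1)] st
    by (simp_all add: rank_one_def herm_scaleC_left herm_scaleC_right hq_self_0_iff
      q_scaleC_left q_scaleC_right flip: mult.assoc)
  moreover have "q_herm (s *\<^sub>C f) z (t *\<^sub>C g) w = s * cnj t * q_herm f z g w" for z w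
    by (simp add: q_herm_def q_scaleC_left sum_distrib_left ring_distribs mult_ac)
  ultimately show ?thesis
    using assms(1) by (simp add: frame_def herm_scaleC_left herm_scaleC_right mult_ac)
qed

text \<open>The discs through the corners of the bidisc spanned by a frame; this is where \<open>a = b\<close>.\<close>

lemma D16_frame_disc:
  assumes "frame f g" "cmod t = 1" "cmod c < 1"
  shows "c *\<^sub>C (f + t *\<^sub>C g) \<in> D16"
proof -
  define d where "d = (if c = 0 then 1 else c / cmod c)"
  have d: "cmod d = 1" "c = cmod c * d"
    by (simp_all add: d_def norm_divide)
  have "c *\<^sub>C (f + t *\<^sub>C g) = cmod c *\<^sub>R (d *\<^sub>C f) + cmod c *\<^sub>R ((d * t) *\<^sub>C g)"
    by (subst d(2)) (simp add: scaleC_add_right scaleC_scaleC mult.assoc flip: scaleC_of_real)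
  moreover have "frame (d *\<^sub>C f) ((d * t) *\<^sub>C g)"
    using assms d(1) by (intro frame_phase) (simp_all add: norm_mult)
  ultimately have "frame_decomp (c *\<^sub>C (f + t *\<^sub>C g)) (cmod c) (d *\<^sub>C f) (cmod c) ((d * t) *\<^sub>C g)"
    by (simp add: frame_decomp_def)
  then show ?thesis
    using assms(3) by (simp add: D16_iff_decomp)
qed

lemma open_D16: "open D16"
proof -
  have "D16 = {z. 0 < generic_norm z} \<inter> {z. norm z < 1}"
    by (auto simp: D16_iff)
  also have "open \<dots>"
    by (intro open_Int open_Collect_less continuous_intros)
  finally show ?thesis .
qed

lemma connected_D16: "connected D16"
proof (rule starlike_imp_connected)
  have "0 \<in> D16"
    by (simp add: D16_iff generic_norm_def q1_def q2_def)
  moreover have "closed_segment 0 z \<subseteq> D16" if "z \<in> D16" for z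
    using D16_scaleR[OF that] by (auto simp: closed_segment_def)
  ultimately show "starlike D16"
    unfolding starlike_def by blast
qed

lemma ball_subset_D16: "ball 0 (1 / sqrt 2) \<subseteq> D16"
proof
  fix z :: m12 assume "z \<in> ball 0 (1 / sqrt 2)"
  then have "norm z < 1 / sqrt 2"
    by simp
  then have "(norm z)\<^sup>2 < (1 / sqrt 2)\<^sup>2"
    by (intro power_strict_mono) simp_all
  then have n: "2 * (norm z)\<^sup>2 < 1"
    by (simp add: power_divide)
  then have "0 < generic_norm z"
    unfolding generic_norm_def by (intro add_pos_nonneg) (simp_all add: sum_nonneg)
  moreover have "norm z < 1"
    using n power_less_one_iff[of "norm z" 2] zero_le_power2[of "norm z"] by simp
  ultimately show "z \<in> D16"
    by (simp add: D16_iff)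
qed

lemma D16_subset_ball: "D16 \<subseteq> ball 0 1"
  by (auto simp: D16_iff)

section \<open>Calculus of holomorphic maps\<close>

lemma holo_onI:
  assumes "\<And>x. x \<in> S \<Longrightarrow> (f has_derivative f' x) (at x)"
    and "\<And>x c v. x \<in> S \<Longrightarrow> f' x (c *\<^sub>C v) = c *\<^sub>C f' x v"
  shows "holo_on f S"
  using assms unfolding holo_on_def by blast

lemma holo_onE:
  assumes "holo_on f S"
  obtains f' where "\<forall>x\<in>S. (f has_derivative f' x) (at x) \<and> (\<forall>c v. f' x (c *\<^sub>C v) = c *\<^sub>C f' x v)"
  using bchoice[OF assms[unfolded holo_on_def]] by blast

lemma holo_on_subset: "holo_on f S \<Longrightarrow> T \<subseteq> S \<Longrightarrow> holo_on f T"
  unfolding holo_on_def by blast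

lemma holo_on_imp_continuous_on:
  assumes "holo_on f S"
  shows "continuous_on S f"
proof -
  have "isCont f x" if "x \<in> S" for x
    using assms that has_derivative_continuous unfolding holo_on_def by blast
  then show ?thesis
    by (simp add: continuous_at_imp_continuous_on)
qed

lemma holo_on_compose:
  assumes "holo_on f S" "holo_on g T" "f ` S \<subseteq> T"
  shows "holo_on (\<lambda>x. g (f x)) S"
proof -
  obtain f' where f: "\<forall>x\<in>S. (f has_derivative f' x) (at x) \<and> (\<forall>c v. f' x (c *\<^sub>C v) = c *\<^sub>C f' x v)"
    using assms(1) by (rule holo_onE)
  obtain g' where g: "\<forall>x\<in>T. (g has_derivative g' x) (at x) \<and> (\<forall>c v. g' x (c *\<^sub>C v) = c *\<^sub>C g' x v)"
    using assms(2) by (rule holo_onE)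
  have T: "f x \<in> T" if "x \<in> S" for x
    using assms(3) that by blast
  show ?thesis
  proof (rule holo_onI)
    show "((\<lambda>x. g (f x)) has_derivative (\<lambda>v. g' (f x) (f' x v))) (at x)" if "x \<in> S" for x
      using f g T that by (intro has_derivative_compose[of f "f' x" x UNIV g "g' (f x)"]) simp_all
  qed (simp add: f g T)
qed

lemma holo_on_linear:
  assumes "linear f" "\<And>c v. f (c *\<^sub>C v) = c *\<^sub>C f v"
  shows "holo_on f S"
  using assms(2)
  by (intro holo_onI[of _ _ "\<lambda>_. f"] bounded_linear_imp_has_derivative)
    (simp_all add: assms(1) flip: linear_conv_bounded_linear)

lemma scaleC_zero_right [simp]: "c *\<^sub>C (0 :: 'a :: complex_euclidean_space) = 0"
  using scaleC_add_right[of c 0 0] by simp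

lemma scaleC_diff_right: "c *\<^sub>C (x - y) = c *\<^sub>C x - c *\<^sub>C (y :: 'a :: complex_euclidean_space)"
  using scaleC_add_right[of c "x - y" y] by (simp add: eq_diff_eq)

lemma scaleC_minus_right: "c *\<^sub>C (- y) = - (c *\<^sub>C (y :: 'a :: complex_euclidean_space))"
  using scaleC_diff_right[of c 0 y] by simp

lemma scaleC_scaleR: "c *\<^sub>C (r *\<^sub>R y) = r *\<^sub>R (c *\<^sub>C (y :: 'a :: complex_euclidean_space))"
  by (simp add: scaleC_scaleC mult.commute flip: scaleC_of_real)

named_theorems holo_intros

lemma holo_on_const [holo_intros]: "holo_on (\<lambda>_. c) S"
  by (rule holo_onI[of _ _ "\<lambda>_ _. 0"]) (auto intro: has_derivative_const)

lemma holo_on_id [holo_intros]: "holo_on (\<lambda>x. x) S"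
  by (rule holo_onI[of _ _ "\<lambda>_ x. x"]) auto

lemma holo_on_add [holo_intros]:
  assumes "holo_on f S" "holo_on g S"
  shows "holo_on (\<lambda>x. f x + g x) S"
proof -
  obtain f' where f: "\<forall>x\<in>S. (f has_derivative f' x) (at x) \<and> (\<forall>c v. f' x (c *\<^sub>C v) = c *\<^sub>C f' x v)"
    using assms(1) by (rule holo_onE)
  obtain g' where g: "\<forall>x\<in>S. (g has_derivative g' x) (at x) \<and> (\<forall>c v. g' x (c *\<^sub>C v) = c *\<^sub>C g' x v)"
    using assms(2) by (rule holo_onE)
  from f g show ?thesis
    by (intro holo_onI[of _ _ "\<lambda>x v. f' x v + g' x v"] has_derivative_add) (simp_all add: scaleC_add_right)
qed

lemma holo_on_minus [holo_intros]:
  assumes "holo_on f S"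
  shows "holo_on (\<lambda>x. - f x) S"
proof -
  obtain f' where "\<forall>x\<in>S. (f has_derivative f' x) (at x) \<and> (\<forall>c v. f' x (c *\<^sub>C v) = c *\<^sub>C f' x v)"
    using assms by (rule holo_onE)
  then show ?thesis
    by (intro holo_onI[of _ _ "\<lambda>x v. - f' x v"] has_derivative_minus) (simp_all add: scaleC_minus_right)
qed

lemma holo_on_diff [holo_intros]: "holo_on f S \<Longrightarrow> holo_on g S \<Longrightarrow> holo_on (\<lambda>x. f x - g x) S"
  using holo_on_add[OF _ holo_on_minus, of f S g] by simp

lemma holo_on_scaleR [holo_intros]:
  assumes "holo_on f S"
  shows "holo_on (\<lambda>x. r *\<^sub>R f x) S"
proof -
  obtain f' where "\<forall>x\<in>S. (f has_derivative f' x) (at x) \<and> (\<forall>c v. f' x (c *\<^sub>C v) = c *\<^sub>C f' x v)"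
    using assms by (rule holo_onE)
  then show ?thesis
    by (intro holo_onI[of _ _ "\<lambda>x v. r *\<^sub>R f' x v"] has_derivative_scaleR_right) (simp_all add: scaleC_scaleR)
qed

lemma holo_on_Pair [holo_intros]:
  assumes "holo_on f S" "holo_on g S"
  shows "holo_on (\<lambda>x. (f x, g x)) S"
proof -
  obtain f' where f: "\<forall>x\<in>S. (f has_derivative f' x) (at x) \<and> (\<forall>c v. f' x (c *\<^sub>C v) = c *\<^sub>C f' x v)"
    using assms(1) by (rule holo_onE)
  obtain g' where g: "\<forall>x\<in>S. (g has_derivative g' x) (at x) \<and> (\<forall>c v. g' x (c *\<^sub>C v) = c *\<^sub>C g' x v)"
    using assms(2) by (rule holo_onE)
  from f g show ?thesis
    by (intro holo_onI[of _ _ "\<lambda>x v. (f' x v, g' x v)"] has_derivative_Pair) (simp_all add: scaleC_prod_def)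
qed

lemma holo_on_mult [holo_intros]:
  fixes f g :: "_ \<Rightarrow> complex"
  assumes "holo_on f S" "holo_on g S"
  shows "holo_on (\<lambda>x. f x * g x) S"
proof -
  obtain f' where f: "\<forall>x\<in>S. (f has_derivative f' x) (at x) \<and> (\<forall>c v. f' x (c *\<^sub>C v) = c *\<^sub>C f' x v)"
    using assms(1) by (rule holo_onE)
  obtain g' where g: "\<forall>x\<in>S. (g has_derivative g' x) (at x) \<and> (\<forall>c v. g' x (c *\<^sub>C v) = c *\<^sub>C g' x v)"
    using assms(2) by (rule holo_onE)
  from f g show ?thesis
    by (intro holo_onI[of _ _ "\<lambda>x v. f x * g' x v + f' x v * g x"] has_derivative_mult)
      (simp_all add: scaleC_complex_def algebra_simps)
qed

lemma holo_on_divide [holo_intros]: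
  fixes f g :: "_ \<Rightarrow> complex"
  assumes "holo_on f S" "holo_on g S" "\<And>x. x \<in> S \<Longrightarrow> g x \<noteq> 0"
  shows "holo_on (\<lambda>x. f x / g x) S"
proof -
  obtain g' where "\<forall>x\<in>S. (g has_derivative g' x) (at x) \<and> (\<forall>c v. g' x (c *\<^sub>C v) = c *\<^sub>C g' x v)"
    using assms(2) by (rule holo_onE)
  then have "holo_on (\<lambda>x. inverse (g x)) S"
    using assms(3)
    by (intro holo_onI[of _ _ "\<lambda>x v. - (inverse (g x) * g' x v * inverse (g x))"] Deriv.has_derivative_inverse)
      (simp_all add: scaleC_complex_def)
  from holo_on_mult[OF assms(1) this] show ?thesis
    by (simp add: divide_inverse)
qed

lemma holo_on_coord [holo_intros]:
  "holo_on X S" "holo_on (\<lambda>z. U z i) S" "holo_on (\<lambda>z. V z i) S" "holo_on (\<lambda>z. W z i) S"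
  by (intro holo_on_linear X_linear U_linear V_linear W_linear; simp add: scaleC_complex_def)+

lemma holo_on_of_coords:
  assumes "holo_on x S" "\<And>i. holo_on (\<lambda>z. u z i) S" "\<And>i. holo_on (\<lambda>z. v z i) S" "\<And>i. holo_on (\<lambda>z. w z i) S"
  shows "holo_on (\<lambda>z. of_coords (x z) (u z) (v z) (w z)) S"
  unfolding of_coords_def of_null_coords_def by (intro holo_intros assms) simp_all

section \<open>Moebius transformations\<close>

text \<open>The \<open>4 \<times> 4\<close> Pfaffians of the antisymmetric matrix.\<close>

definition pfaffian :: "m12 \<Rightarrow> 5 \<Rightarrow> complex" where
  "pfaffian z i = U z (i + 1) * U z (i + 3) - V z (i + 1) * V z (i + 2) - V z (i + 4) * U z (i + 2)"

text \<open>The transvection along the minimal tripotent \<open>e\<close> with \<open>x = 1\<close>: on the three Peirce spaces of \<open>e\<close>, with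
  coordinates \<open>x\<close>, \<open>y\<close> and \<open>w\<close>, it is the disc automorphism \<open>x \<mapsto> (x + t) / c\<close>, multiplication by the square root of its
  derivative, and a shear by the Pfaffians.\<close>

definition moebius :: "complex \<Rightarrow> m12 \<Rightarrow> m12" where
  "moebius t z = (let c = 1 + cnj t * X z; s = complex_of_real (sqrt (1 - (cmod t)\<^sup>2)) in
     of_coords ((X z + t) / c) (\<lambda>i. s * U z i / c) (\<lambda>i. s * V z i / c) (\<lambda>i. W z i + cnj t * pfaffian z i / c))"

lemma q1_self: "q1 z z i = X z * W z i + pfaffian z i"
  by (simp add: q1_def pfaffian_def)

text \<open>The matrix annihilates the vector of its Pfaffians.\<close>

lemma pfaffian_relation:
  "U z i * pfaffian z (i + 1) + V z i * pfaffian z (i + 2) - V z (i + 3) * pfaffian z (i + 3) - U z (i + 4) * pfaffian z (i + 4) = 0"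
  (is "?l i = 0")
proof -
  have "\<forall>i. ?l i = 0"
    unfolding forall_5 by (simp add: pfaffian_def algebra_simps)
  then show ?thesis ..
qed

context
  fixes t :: complex and c :: complex and s :: complex and z :: m12
  assumes t: "cmod t < 1"
  defines "c \<equiv> 1 + cnj t * X z"
  defines "s \<equiv> complex_of_real (sqrt (1 - (cmod t)\<^sup>2))"
  assumes c: "c \<noteq> 0"
begin

lemma moebius_coord:
  "X (moebius t z) = (X z + t) / c" "U (moebius t z) i = s * U z i / c" "V (moebius t z) i = s * V z i / c"
  "W (moebius t z) i = (c * W z i + cnj t * pfaffian z i) / c"
  using c by (simp_all add: moebius_def Let_def add_divide_distrib flip: c_def s_def)

lemma s_square: "s * s = 1 - t * cnj t" "s * (s * x) = (1 - t * cnj t) * x" "cnj s = s"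
proof -
  have "(cmod t)\<^sup>2 \<le> 1"
    using t by (simp add: power_le_one)
  then have "s * s = complex_of_real (1 - (cmod t)\<^sup>2)"
    unfolding s_def by (simp flip: of_real_mult)
  then show *: "s * s = 1 - t * cnj t"
    using complex_norm_square[of t] by simp
  show "s * (s * x) = (1 - t * cnj t) * x"
    by (simp add: * flip: mult.assoc)
  show "cnj s = s"
    by (simp add: s_def)
qed

lemma pfaffian_moebius: "pfaffian (moebius t z) i = (1 - t * cnj t) * pfaffian z i / (c * c)"
  using c by (simp add: pfaffian_def moebius_coord field_simps s_square)

lemma q_moebius:
  "q1 (moebius t z) (moebius t z) i = ((X z + t) * W z i + pfaffian z i) / c"
  "q2 (moebius t z) (moebius t z) i = s * q2 z z i / c"
proof -
  have "q1 (moebius t z) (moebius t z) i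
      = ((X z + t) * (c * W z i + cnj t * pfaffian z i) + (1 - t * cnj t) * pfaffian z i) / (c * c)"
    unfolding q1_self pfaffian_moebius moebius_coord
    by (simp only: times_divide_times_eq add_divide_distrib[symmetric])
  also have "(X z + t) * (c * W z i + cnj t * pfaffian z i) + (1 - t * cnj t) * pfaffian z i
      = c * ((X z + t) * W z i + pfaffian z i)"
    by (simp add: c_def algebra_simps)
  finally show "q1 (moebius t z) (moebius t z) i = ((X z + t) * W z i + pfaffian z i) / c"
    using c by simp
  have "q2 (moebius t z) (moebius t z) i = (s * c * q2 z z i
     + s * cnj t * (U z i * pfaffian z (i + 1) + V z i * pfaffian z (i + 2) - V z (i + 3) * pfaffian z (i + 3) - U z (i + 4) * pfaffian z (i + 4))) / (c * c)"
    using c unfolding q2_def moebius_coord by (simp add: field_simps)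
  then show "q2 (moebius t z) (moebius t z) i = s * q2 z z i / c"
    unfolding pfaffian_relation using c by simp
qed

text \<open>After multiplication by \<open>|c|\<^sup>2\<close> every summand acquires the factor \<open>1 - |t|\<^sup>2\<close>.  For the Pfaffian and
  vector parts this needs their contributions to \<open>\<langle>z,z\<rangle>\<close> and to \<open>|q(z)|\<^sup>2\<close> together (fact \<open>w\<close>).\<close>

lemma generic_norm_moebius: "generic_norm (moebius t z) = (1 - (cmod t)\<^sup>2) * generic_norm z / (cmod c)\<^sup>2"
proof -
  define T where "T = 1 - t * cnj t"
  have div: "a / c * cnj (a / c) = a * cnj a / (c * cnj c)"
    and div_s: "s * a / c * cnj (s * a / c) = T * (a * cnj a) / (c * cnj c)" for a
    by (simp_all add: T_def s_square mult_ac)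
  have h: "herm (moebius t z) (moebius t z) = ((X z + t) * cnj (X z + t)
      + (\<Sum>i\<in>UNIV. T * (U z i * cnj (U z i)) + T * (V z i * cnj (V z i))
          + (c * W z i + cnj t * pfaffian z i) * cnj (c * W z i + cnj t * pfaffian z i))) / (c * cnj c)"
    unfolding herm_def moebius_coord div_s unfolding div
    by (simp only: add_divide_distrib sum_divide_distrib)
  have q: "q_herm (moebius t z) (moebius t z) (moebius t z) (moebius t z)
     = (\<Sum>i\<in>UNIV. ((X z + t) * W z i + pfaffian z i) * cnj ((X z + t) * W z i + pfaffian z i)
          + T * (q2 z z i * cnj (q2 z z i))) / (c * cnj c)"
    unfolding q_herm_def q_moebius div_s unfolding div
    by (simp only: add_divide_distrib sum_divide_distrib)
  have w: "((X z + t) * W z i + pfaffian z i) * cnj ((X z + t) * W z i + pfaffian z i)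
      = (c * W z i + cnj t * pfaffian z i) * cnj (c * W z i + cnj t * pfaffian z i)
        + T * (q1 z z i * cnj (q1 z z i) - W z i * cnj (W z i))" for i
    by (simp add: c_def T_def q1_self algebra_simps)
  have x: "c * cnj c - (X z + t) * cnj (X z + t) = T * (1 - X z * cnj (X z))"
    by (simp add: c_def T_def algebra_simps)
  define sU sV sW s1 s2 sY where sums: "sU = (\<Sum>i\<in>UNIV. U z i * cnj (U z i))"
    "sV = (\<Sum>i\<in>UNIV. V z i * cnj (V z i))" "sW = (\<Sum>i\<in>UNIV. W z i * cnj (W z i))"
    "s1 = (\<Sum>i\<in>UNIV. q1 z z i * cnj (q1 z z i))" "s2 = (\<Sum>i\<in>UNIV. q2 z z i * cnj (q2 z z i))"
    "sY = (\<Sum>i\<in>UNIV. (c * W z i + cnj t * pfaffian z i) * cnj (c * W z i + cnj t * pfaffian z i))"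
  have h': "herm (moebius t z) (moebius t z) * (c * cnj c) = (X z + t) * cnj (X z + t) + T * sU + T * sV + sY"
    unfolding h sums sum.distrib sum_distrib_left using c by simp
  have q': "q_herm (moebius t z) (moebius t z) (moebius t z) (moebius t z) * (c * cnj c) = sY + T * (s1 - sW) + T * s2"
    unfolding q w sums sum.distrib sum_distrib_left[symmetric] sum_subtractf using c by simp
  have "complex_of_real (generic_norm (moebius t z)) * (c * cnj c)
      = c * cnj c - herm (moebius t z) (moebius t z) * (c * cnj c) + q_herm (moebius t z) (moebius t z) (moebius t z) (moebius t z) * (c * cnj c)"
    by (simp add: generic_norm_q_herm ring_distribs)
  also have "\<dots> = (c * cnj c - (X z + t) * cnj (X z + t)) - T * sU - T * sV - T * sW + T * s1 + T * s2"
    unfolding h' q' by (simp only: right_diff_distrib) simp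
  also have "\<dots> = T * (1 - (X z * cnj (X z) + (sU + sV + sW)) + (s1 + s2))"
    unfolding x by (simp only: right_diff_distrib distrib_left) simp
  also have "1 - (X z * cnj (X z) + (sU + sV + sW)) + (s1 + s2) = of_real (generic_norm z)"
    by (simp add: generic_norm_q_herm herm_def q_herm_def sums sum.distrib)
  also have "T = of_real (1 - (cmod t)\<^sup>2)"
    using complex_norm_square[of t] by (simp add: T_def)
  finally have "complex_of_real (generic_norm (moebius t z) * (cmod c)\<^sup>2) = of_real ((1 - (cmod t)\<^sup>2) * generic_norm z)"
    by (simp only: of_real_mult complex_norm_square[of c])
  then show ?thesis
    unfolding of_real_eq_iff using c by (simp add: field_simps)
qed

lemma moebius_inverse: "moebius (- t) (moebius t z) = z"
proof -
  have d: "1 + cnj (- t) * X (moebius t z) = (1 - t * cnj t) / c"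
    using c unfolding moebius_coord by (simp add: c_def field_simps)
  have nz: "1 - t * cnj t \<noteq> 0"
  proof -
    have "(cmod t)\<^sup>2 < 1"
      using t by (simp add: power_less_one_iff)
    then have "complex_of_real (1 - (cmod t)\<^sup>2) \<noteq> 0"
      unfolding of_real_eq_0_iff by simp
    then show ?thesis
      using complex_norm_square[of t] by simp
  qed
  show ?thesis
    unfolding moebius_def[of "- t"] Let_def d norm_minus_cancel s_def[symmetric]
  proof (rule coord_eqI; unfold coord_of_coords pfaffian_moebius; unfold moebius_coord)
    show "((X z + t) / c + - t) / ((1 - t * cnj t) / c) = X z"
      using c nz by (simp add: divide_simps) (simp add: c_def algebra_simps)
  qed (use c nz in \<open>simp_all add: s_square divide_simps\<close>)
qed

end

lemma moebius_denominator:
  assumes "cmod t < 1" "z \<in> D16"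
  shows "1 + cnj t * X z \<noteq> 0"
proof
  assume "1 + cnj t * X z = 0"
  then have "cmod (cnj t * X z) = 1"
    by (metis add_eq_0_iff norm_minus_cancel norm_one)
  moreover have "cmod (cnj t * X z) < 1"
    using mult_strict_mono'[OF assms(1) D16_X[OF assms(2)]] by (simp add: norm_mult)
  ultimately show False
    by simp
qed

lemma holo_on_moebius:
  assumes "cmod t < 1"
  shows "holo_on (moebius t) D16"
proof -
  have "holo_on (\<lambda>z. pfaffian z i) S" for i and S :: "m12 set"
    unfolding pfaffian_def by (intro holo_intros)
  then show ?thesis
    unfolding moebius_def Let_def using moebius_denominator[OF assms]
    by (intro holo_on_of_coords holo_intros) simp_all
qed

lemma zero_in_D16: "0 \<in> D16"
  by (simp add: D16_iff generic_norm_def q1_def q2_def)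

text \<open>The generic norm is positive along the image of the segment from \<open>0\<close> to \<open>z\<close>, and this path starts inside
  the Euclidean unit ball, so it stays there.\<close>

lemma moebius_D16:
  assumes t: "cmod t < 1" and z: "z \<in> D16"
  shows "moebius t z \<in> D16"
proof -
  have t2: "0 < 1 - (cmod t)\<^sup>2"
    using t by (simp add: power_less_one_iff)
  have N: "0 < generic_norm (moebius t y)" if "y \<in> D16" for y
    using generic_norm_moebius[OF t moebius_denominator[OF t that]] moebius_denominator[OF t that] that t2
    by (simp add: D16_iff)
  define h where "h = (\<lambda>r. norm (moebius t (r *\<^sub>R z)))"
  have "continuous_on {0..1} (\<lambda>r. moebius t (r *\<^sub>R z))"
    using D16_scaleR[OF z]
    by (intro continuous_on_compose2[OF holo_on_imp_continuous_on[OF holo_on_moebius[OF t]]] continuous_intros) auto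
  then have cont: "continuous_on {0..1} h"
    unfolding h_def by (intro continuous_intros)
  have "moebius t 0 = of_coords t (\<lambda>_. 0) (\<lambda>_. 0) (\<lambda>_. 0)"
    by (simp add: moebius_def pfaffian_def)
  then have "herm (moebius t 0) (moebius t 0) = t * cnj t"
    by (simp add: herm_def)
  then have "complex_of_real (2 * (norm (moebius t 0))\<^sup>2) = of_real ((cmod t)\<^sup>2)"
    unfolding herm_self complex_norm_square .
  then have "(norm (moebius t 0))\<^sup>2 < 1"
    unfolding of_real_eq_iff using t2 by simp
  then have h0: "h 0 < 1"
    by (simp add: h_def power_less_one_iff)
  have "h 1 < 1"
  proof (rule ccontr)
    assume "\<not> h 1 < 1"
    then have "\<exists>r. 0 \<le> r \<and> r \<le> 1 \<and> h r = 1"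
      using h0 cont by (intro IVT') simp_all
    then obtain r where r: "0 \<le> r" "r \<le> 1" "norm (moebius t (r *\<^sub>R z)) = 1"
      by (auto simp: h_def)
    then show False
      using generic_norm_nonpos[OF r(3)] N[OF D16_scaleR[OF z r(1,2)]] by simp
  qed
  then show ?thesis
    using N[OF z] by (simp add: D16_iff h_def)
qed

section \<open>Automorphisms and their orbits\<close>

definition automorphism :: "'a::complex_euclidean_space set \<Rightarrow> ('a \<Rightarrow> 'a) \<Rightarrow> bool" where
  "automorphism D f \<longleftrightarrow> holo_on f D \<and> f ` D \<subseteq> D \<and>
    (\<exists>g. holo_on g D \<and> g ` D \<subseteq> D \<and> (\<forall>z\<in>D. g (f z) = z \<and> f (g z) = z))"

lemma automorphism_id: "automorphism D (\<lambda>z. z)"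
  unfolding automorphism_def by (auto intro!: holo_on_id exI[of _ "\<lambda>z. z"])

lemma automorphism_compose:
  assumes "automorphism D f" "automorphism D h"
  shows "automorphism D (\<lambda>z. f (h z))"
proof -
  obtain g where g: "holo_on g D" "g ` D \<subseteq> D" "\<forall>z\<in>D. g (f z) = z \<and> f (g z) = z"
    using assms(1) unfolding automorphism_def by blast
  obtain k where k: "holo_on k D" "k ` D \<subseteq> D" "\<forall>z\<in>D. k (h z) = z \<and> h (k z) = z"
    using assms(2) unfolding automorphism_def by blast
  have f: "holo_on f D" "f ` D \<subseteq> D" and h: "holo_on h D" "h ` D \<subseteq> D"
    using assms by (simp_all add: automorphism_def)
  have "holo_on (\<lambda>z. f (h z)) D" "holo_on (\<lambda>z. k (g z)) D"
    using f g h k by (auto intro: holo_on_compose)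
  moreover have "\<forall>z\<in>D. k (g (f (h z))) = z \<and> f (h (k (g z))) = z"
    using f(2) g h(2) k by (simp add: image_subset_iff)
  ultimately show ?thesis
    unfolding automorphism_def using f(2) g(2) h(2) k(2)
    by (intro conjI exI[of _ "\<lambda>z. k (g z)"]) (auto simp: image_subset_iff)
qed

lemma automorphism_image:
  assumes "automorphism D f"
  shows "f ` D = D"
  using assms unfolding automorphism_def by (metis image_eqI image_subset_iff subset_antisym subsetI)

lemma automorphism_moebius:
  assumes "cmod t < 1"
  shows "automorphism D16 (moebius t)"
proof -
  have t': "cmod (- t) < 1"
    using assms by simp
  have "moebius (- t) (moebius t z) = z" "moebius t (moebius (- t) z) = z" if "z \<in> D16" for z
    using moebius_inverse[OF assms moebius_denominator[OF assms that]]
      moebius_inverse[OF t' moebius_denominator[OF t' that]] by simp_all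
  then show ?thesis
    unfolding automorphism_def
    using holo_on_moebius[OF assms] holo_on_moebius[OF t'] moebius_D16[OF assms] moebius_D16[OF t']
    by (intro conjI exI[of _ "moebius (- t)"]) auto
qed

lemma spin_map_D16:
  assumes "spin_map k"
  shows "k z \<in> D16 \<longleftrightarrow> z \<in> D16"
  by (simp add: D16_iff spin_map_generic_norm[OF assms] spin_map_norm[OF assms])

lemma automorphism_spin_map:
  assumes "spin_map k"
  shows "automorphism D16 k"
proof -
  obtain l where l: "spin_map l" "\<And>z. l (k z) = z" "\<And>z. k (l z) = z"
    using spin_map_inverse[OF assms] by metis
  have "holo_on k D16" "holo_on l D16"
    using spin_mapD(1,2)[OF assms] spin_mapD(1,2)[OF l(1)] by (auto intro: holo_on_linear)
  then show ?thesis
    unfolding automorphism_def using l spin_map_D16[OF assms] spin_map_D16[OF l(1)]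
    by (intro conjI exI[of _ l]) auto
qed

text \<open>Move \<open>z\<close> to a point with first coordinate \<open>x \<noteq> 0\<close> and apply the Moebius transformation that sends \<open>x\<close> to \<open>0\<close>;
  the generic norm is divided by \<open>1 - |x|\<^sup>2\<close>.\<close>

lemma automorphism_increases_generic_norm:
  assumes z: "z \<in> D16" "z \<noteq> 0"
  obtains f where "automorphism D16 f" "generic_norm z < generic_norm (f z)"
proof -
  obtain k where k: "spin_map k" "X (k z) \<noteq> 0"
    using spin_map_X_nonzero[OF z(2)] .
  define t where "t = - X (k z)"
  have kz: "k z \<in> D16"
    using z(1) by (simp add: spin_map_D16[OF k(1)])
  then have t: "cmod t < 1"
    using D16_X by (simp add: t_def)
  define d where "d = 1 - (cmod t)\<^sup>2"
  have d: "0 < d" "d < 1"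
    using t k(2) by (simp_all add: d_def t_def power_less_one_iff)
  have c: "1 + cnj t * X (k z) = of_real d"
    using complex_norm_square[of t] by (simp add: t_def d_def mult.commute)
  have "generic_norm (moebius t (k z)) = d * generic_norm z / (cmod (of_real d))\<^sup>2"
    unfolding generic_norm_moebius[OF t moebius_denominator[OF t kz]] spin_map_generic_norm[OF k(1)] c d_def ..
  then have "generic_norm (moebius t (k z)) = generic_norm z / d"
    using d by (simp add: power2_eq_square)
  moreover have "generic_norm z < generic_norm z / d"
    using z(1) d by (simp add: D16_iff pos_less_divide_eq)
  moreover have "automorphism D16 (\<lambda>z. moebius t (k z))"
    by (intro automorphism_compose[of D16 "moebius t" k] automorphism_moebius automorphism_spin_map t k)
  ultimately show ?thesis
    using that by metis
qed

text \<open>On the closure of the orbit the generic norm attains its maximum, at a point that again lies in the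
  domain because the generic norm is positive there.  If that point were not \<open>0\<close>, an automorphism would
  increase the generic norm further.\<close>

lemma orbit_accumulates_at_0:
  assumes p: "p \<in> D16" and e: "0 < e"
  obtains f where "automorphism D16 f" "norm (f p) < e"
proof -
  define S where "S = {f p |f. automorphism D16 f}"
  have S: "S \<subseteq> D16"
    using p automorphism_image unfolding S_def by blast
  then have "bounded S"
    using D16_subset_ball bounded_subset[OF bounded_ball] by blast
  then have "compact (closure S)"
    by (simp add: compact_closure)
  moreover have pS: "p \<in> S"
    unfolding S_def using automorphism_id by force
  then have "closure S \<noteq> {}"
    by auto
  moreover have "continuous_on (closure S) generic_norm"
    by (intro generic_norm_continuous[of _ "\<lambda>x. x", simplified] continuous_intros)
  ultimately have "\<exists>m\<in>closure S. \<forall>y\<in>closure S. generic_norm y \<le> generic_norm m"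
    using continuous_attains_sup by blast
  then obtain m where m: "m \<in> closure S" and max: "\<forall>y\<in>closure S. generic_norm y \<le> generic_norm m"
    by (rule bexE)
  have Nm: "0 < generic_norm m"
  proof -
    have "generic_norm p \<le> generic_norm m"
      using max pS closure_subset by blast
    then show ?thesis
      using p by (simp add: D16_iff)
  qed
  have "closure S \<subseteq> cball 0 1"
    using S D16_subset_ball by (intro closure_minimal) auto
  then have "norm m \<le> 1"
    using m by auto
  moreover have "norm m \<noteq> 1"
    using generic_norm_nonpos[of m] Nm by linarith
  ultimately have mD: "m \<in> D16"
    using Nm by (simp add: D16_iff)
  have "m = 0"
  proof (rule ccontr)
    assume "m \<noteq> 0"
    then obtain f where f: "automorphism D16 f" "generic_norm m < generic_norm (f m)"
      using automorphism_increases_generic_norm[OF mD] by metis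
    have "isCont f m"
      using f(1) mD open_D16 holo_on_imp_continuous_on[of f D16]
      by (simp add: automorphism_def continuous_on_eq_continuous_at)
    obtain y where y: "\<And>n::nat. y n \<in> S" "y \<longlonglongrightarrow> m"
      using m unfolding closure_sequential by blast
    have "(\<lambda>n. f (y n)) \<longlonglongrightarrow> f m"
      by (rule isCont_tendsto_compose[OF \<open>isCont f m\<close> y(2)])
    moreover have "f (y n) \<in> S" for n
    proof -
      obtain h where "automorphism D16 h" "y n = h p"
        using y(1)[of n] by (auto simp: S_def)
      then show ?thesis
        unfolding S_def using automorphism_compose[OF f(1), of h]
        by (intro CollectI exI[of _ "\<lambda>z. f (h z)"]) simp
    qed
    ultimately have "f m \<in> closure S"
      unfolding closure_sequential by (intro exI[of _ "\<lambda>n. f (y n)"]) blast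
    then show False
      using max f(2) by force
  qed
  with m e obtain y where "y \<in> S" "dist y 0 < e"
    unfolding closure_approachable by blast
  then show ?thesis
    using that by (auto simp: S_def)
qed

section \<open>The lower bound\<close>

text \<open>The set whose supremum is \<open>squeezing\<close>.\<close>

definition squeezing_radii :: "'a::complex_euclidean_space set \<Rightarrow> 'a \<Rightarrow> real set" where
  "squeezing_radii D p =
    {r. r > 0 \<and> (\<exists>f :: 'a \<Rightarrow> 'a. holo_embedding f D (ball 0 1) \<and> f p = 0 \<and> ball 0 r \<subseteq> f ` D)}"

lemma squeezing_radii_le_1:
  assumes "r \<in> squeezing_radii D p"
  shows "r \<le> 1"
proof -
  have "ball (0 :: 'a) r \<subseteq> ball 0 1" "0 < r"
    using assms by (auto simp: squeezing_radii_def holo_embedding_def)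
  then show ?thesis
    by (simp add: ball_subset_ball_iff)
qed

lemma squeezing_radii_automorphism:
  fixes D :: "'a::complex_euclidean_space set"
  assumes "automorphism D h" "p \<in> D"
  shows "squeezing_radii D (h p) \<subseteq> squeezing_radii D p"
proof
  fix r assume "r \<in> squeezing_radii D (h p)"
  then obtain f :: "'a \<Rightarrow> 'a" where r: "r > 0" and f: "holo_embedding f D (ball 0 1)" "f (h p) = 0" "ball 0 r \<subseteq> f ` D"
    by (auto simp: squeezing_radii_def)
  obtain k where k: "holo_on k D" "k ` D \<subseteq> D" "\<forall>z\<in>D. k (h z) = z \<and> h (k z) = z"
    and h: "holo_on h D" "h ` D \<subseteq> D"
    using assms(1) unfolding automorphism_def by blast
  obtain g where g: "holo_on g (f ` D)" "\<forall>x\<in>D. g (f x) = x"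
    and fD: "holo_on f D" "f ` D \<subseteq> ball 0 1" "open (f ` D)" "connected (f ` D)"
    using f(1) unfolding holo_embedding_def by blast
  have img: "(\<lambda>x. f (h x)) ` D = f ` D"
    using automorphism_image[OF assms(1)] by (metis image_image)
  have "holo_on (\<lambda>x. f (h x)) D"
    by (rule holo_on_compose[OF h(1) fD(1) h(2)])
  moreover have "holo_on (\<lambda>y. k (g y)) (f ` D)"
    by (rule holo_on_compose[OF g(1) k(1)]) (use g(2) in auto)
  moreover have "\<forall>x\<in>D. k (g (f (h x))) = x"
    using g(2) k(3) h(2) by auto
  ultimately have "holo_embedding (\<lambda>x. f (h x)) D (ball 0 1)"
    unfolding holo_embedding_def img using fD by blast
  then show "r \<in> squeezing_radii D p"
    unfolding squeezing_radii_def using r f(2,3) img by blast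
qed

text \<open>The embedding is the translation by \<open>- q\<close>, scaled by \<open>1 / (1 + \<parallel>q\<parallel>)\<close> to fit into the unit ball.\<close>

lemma squeezing_radii_near_0:
  assumes q: "norm q < 1 / (2 * sqrt 2)" "q \<in> D16"
  shows "1 / sqrt 2 - 2 * norm q \<in> squeezing_radii D16 q"
proof -
  define c where "c = 1 + norm q"
  define f where "f = (\<lambda>z :: m12. (1 / c) *\<^sub>R (z - q))"
  define g where "g = (\<lambda>w :: m12. c *\<^sub>R w + q)"
  have c: "c > 0"
    by (simp add: c_def add_pos_nonneg)
  have fg: "f (g w) = w" "g (f z) = z" for z w
    using c by (simp_all add: f_def g_def)
  have holo: "holo_on f A" "holo_on g A" for A
    unfolding f_def g_def by (intro holo_intros)+
  have img: "f ` D16 = g -` D16"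
  proof (intro equalityI subsetI)
    show "w \<in> g -` D16" if "w \<in> f ` D16" for w
      using that by (elim imageE) (simp add: fg(2))
    show "w \<in> f ` D16" if "w \<in> g -` D16" for w
      using that by (intro image_eqI[of _ _ "g w"]) (simp_all add: fg(1))
  qed
  have "f ` D16 \<subseteq> ball 0 1"
  proof (rule image_subsetI)
    fix z :: m12 assume "z \<in> D16"
    then have "norm (z - q) < c"
      using norm_triangle_ineq4[of z q] by (simp add: c_def D16_iff)
    then show "f z \<in> ball 0 1"
      using c by (simp add: f_def)
  qed
  moreover have "open (f ` D16)"
    unfolding img by (intro open_vimage open_D16 holo_on_imp_continuous_on holo)
  moreover have "connected (f ` D16)"
    by (intro connected_continuous_image connected_D16 holo_on_imp_continuous_on holo)
  ultimately have "holo_embedding f D16 (ball 0 1)"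
    unfolding holo_embedding_def using holo fg by blast
  moreover have "f q = 0"
    by (simp add: f_def)
  moreover have "ball 0 (1 / sqrt 2 - 2 * norm q) \<subseteq> f ` D16"
  proof
    fix w :: m12 assume "w \<in> ball 0 (1 / sqrt 2 - 2 * norm q)"
    then have w: "norm w < 1 / sqrt 2 - 2 * norm q"
      by simp
    have "norm (g w) \<le> c * norm w + norm q"
      using norm_triangle_ineq[of "c *\<^sub>R w" q] c by (simp add: g_def)
    also have "\<dots> < c * (1 / sqrt 2 - 2 * norm q) + norm q"
      using w c by simp
    also have "\<dots> \<le> 1 / sqrt 2"
    proof -
      have "norm q * (1 / sqrt 2) \<le> norm q * 1"
        by (intro mult_left_mono) simp_all
      moreover have "(1 + n) * (a - 2 * n) + n \<le> a" if "n * a \<le> n * 1" for n a :: real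
      proof -
        have "(1 + n) * (a - 2 * n) + n = a + (n * a - n * 1) - 2 * (n * n)"
          by (simp add: algebra_simps)
        then show ?thesis
          using that zero_le_square[of n] by linarith
      qed
      ultimately show ?thesis
        unfolding c_def by blast
    qed
    finally have "g w \<in> D16"
      using ball_subset_D16 by auto
    then show "w \<in> f ` D16"
      by (simp add: img)
  qed
  moreover have "1 / sqrt 2 - 2 * norm q > 0"
    using q by (simp add: field_simps)
  ultimately show ?thesis
    unfolding squeezing_radii_def by blast
qed

lemma squeezing_alt: "squeezing D p = Sup (squeezing_radii D p)"
  by (simp add: squeezing_def squeezing_radii_def)

lemma squeezing_D16_ge:
  assumes "p \<in> D16"
  shows "1 / sqrt 2 \<le> squeezing D16 p"
proof (rule field_le_epsilon)
  fix e :: real assume "0 < e"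
  define d where "d = min (e / 2) (1 / (2 * sqrt 2))"
  have "0 < d"
    using \<open>0 < e\<close> by (simp add: d_def)
  then obtain h where h: "automorphism D16 h" "norm (h p) < d"
    using orbit_accumulates_at_0[OF assms] by metis
  have "h p \<in> D16"
    using assms automorphism_image[OF h(1)] by blast
  then have "1 / sqrt 2 - 2 * norm (h p) \<in> squeezing_radii D16 (h p)"
    using h(2) by (intro squeezing_radii_near_0) (simp_all add: d_def)
  then have "1 / sqrt 2 - 2 * norm (h p) \<in> squeezing_radii D16 p"
    using squeezing_radii_automorphism[OF h(1) assms] by blast
  then have "1 / sqrt 2 - 2 * norm (h p) \<le> squeezing D16 p"
    unfolding squeezing_alt
    by (rule cSup_upper) (auto intro!: bdd_aboveI[of _ 1] squeezing_radii_le_1)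
  with h(2) show "1 / sqrt 2 \<le> squeezing D16 p + e"
    by (simp add: d_def)
qed

section \<open>The upper bound\<close>

text \<open>The one-variable Schwarz lemma on the disc \<open>c \<mapsto> c v\<close>.\<close>

lemma Schwarz_directional:
  fixes h :: "'a::complex_euclidean_space \<Rightarrow> complex"
  assumes h: "holo_on h D" "h 0 = 0" and bound: "\<And>z. z \<in> D \<Longrightarrow> cmod (h z) < 1"
    and L: "(h has_derivative L) (at 0)"
    and v: "\<And>c. cmod c < 1 \<Longrightarrow> c *\<^sub>C v \<in> D"
  shows "cmod (L v) \<le> 1"
proof -
  define \<phi> where "\<phi> = (\<lambda>c. h (c *\<^sub>C v))"
  have lin: "((\<lambda>c. c *\<^sub>C v) has_derivative (\<lambda>d. d *\<^sub>C v)) (at c)" for c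
    by (intro bounded_linear_imp_has_derivative)
      (simp add: linear_iff scaleC_add_left scaleC_of_real scaleC_scaleC scaleR_conv_of_real flip: linear_conv_bounded_linear scaleC_of_real)
  obtain h' where h': "\<forall>x\<in>D. (h has_derivative h' x) (at x) \<and> (\<forall>c v. h' x (c *\<^sub>C v) = c *\<^sub>C h' x v)"
    using h(1) by (rule holo_onE)
  have \<phi>': "(\<phi> has_field_derivative h' (c *\<^sub>C v) v) (at c)" if "cmod c < 1" for c
  proof -
    have "(\<phi> has_derivative (\<lambda>d. h' (c *\<^sub>C v) (d *\<^sub>C v))) (at c)"
      unfolding \<phi>_def using h' v[OF that]
      by (intro has_derivative_compose[OF lin]) simp
    moreover have "(\<lambda>d. h' (c *\<^sub>C v) (d *\<^sub>C v)) = (*) (h' (c *\<^sub>C v) v)"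
      using h' v[OF that] by (auto simp: scaleC_complex_def)
    ultimately show ?thesis
      by (simp add: has_field_derivative_def)
  qed
  have "0 \<in> D"
    using v[of 0] scaleC_of_real[of 0 v] by simp
  then have "h' 0 = L"
    using h' L has_derivative_unique by blast
  then have "deriv \<phi> 0 = L v"
    using DERIV_imp_deriv[OF \<phi>'[of 0]] scaleC_of_real[of 0 v] by simp
  moreover have "\<phi> holomorphic_on ball 0 1"
    using \<phi>' by (intro holomorphic_onI) (auto simp: field_differentiable_def intro: has_field_derivative_at_within)
  moreover have "\<phi> 0 = 0"
    using h(2) scaleC_of_real[of 0 v] by (simp add: \<phi>_def)
  ultimately show ?thesis
    using Schwarz_Lemma(2)[of \<phi> 0] bound v by (simp add: \<phi>_def)
qed

lemma cmod_herm_le: "cmod (herm z w) \<le> 2 * norm z * norm w"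
proof (cases "herm z w = 0")
  case False
  define t where "t = cnj (herm z w) / cmod (herm z w)"
  have t: "cmod t = 1"
    using False by (simp add: t_def norm_divide)
  have "herm (t *\<^sub>C z) w = herm z w * cnj (herm z w) / cmod (herm z w)"
    by (simp add: herm_scaleC_left t_def)
  also have "\<dots> = cmod (herm z w)"
    using False unfolding complex_norm_square[symmetric] by (simp add: power2_eq_square)
  finally have "herm (t *\<^sub>C z) w = cmod (herm z w)" .
  then have "cmod (herm z w) = 2 * ((t *\<^sub>C z) \<bullet> w)"
    using Re_herm[of "t *\<^sub>C z" w] by simp
  also have "\<dots> \<le> 2 * (norm (t *\<^sub>C z) * norm w)"
    using norm_cauchy_schwarz[of "t *\<^sub>C z" w] by simp
  finally show ?thesis
    by (simp add: norm_scaleC t)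
qed simp

text \<open>Compose with the norming functional of \<open>L v\<close>.\<close>

lemma Schwarz_directional_ball:
  fixes f :: "m12 \<Rightarrow> m12"
  assumes f: "holo_on f D" "f 0 = 0" "f ` D \<subseteq> ball 0 1"
    and L: "(f has_derivative L) (at 0)"
    and v: "\<And>c. cmod c < 1 \<Longrightarrow> c *\<^sub>C v \<in> D"
  shows "norm (L v) \<le> 1"
proof (cases "L v = 0")
  case False
  define y where "y = (1 / (2 * norm (L v))) *\<^sub>R L v"
  have lin: "linear (\<lambda>u. herm u y)"
    by (simp add: linear_iff herm_add_left scaleR_conv_of_real)
  have le: "cmod (herm u y) \<le> norm u" for u
    using cmod_herm_le[of u y] False by (simp add: y_def)
  have "cmod (herm (L v) y) \<le> 1"
  proof (rule Schwarz_directional[where h = "\<lambda>z. herm (f z) y" and L = "\<lambda>u. herm (L u) y"])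
    have "holo_on (\<lambda>u. herm u y) UNIV"
      by (rule holo_on_linear[OF lin]) (simp add: herm_scaleC_left scaleC_complex_def)
    then show "holo_on (\<lambda>z. herm (f z) y) D"
      by (rule holo_on_compose[OF f(1) _ subset_UNIV])
    show "((\<lambda>z. herm (f z) y) has_derivative (\<lambda>u. herm (L u) y)) (at 0)"
      using lin by (intro has_derivative_compose[OF L] bounded_linear_imp_has_derivative)
        (simp add: linear_conv_bounded_linear)
    show "cmod (herm (f z) y) < 1" if "z \<in> D" for z
      using le[of "f z"] f(3) that by fastforce
  qed (simp_all add: f v)
  moreover have "herm (L v) y = norm (L v)"
    using False by (simp add: y_def herm_self power2_eq_square)
  ultimately show ?thesis
    by simp
qed simp

text \<open>The functional \<open>X \<circ> k\<close> is bounded by \<open>1\<close> on the domain, so on the ball of radius \<open>r\<close> its composition with the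
  inverse \<open>g\<close> of \<open>f\<close> obeys the Schwarz lemma.  Its derivative maps \<open>L e\<close> to a number of modulus \<open>1\<close>, hence \<open>L e\<close> cannot be
  shorter than \<open>r\<close>.\<close>

lemma squeezing_radius_le:
  fixes f :: "m12 \<Rightarrow> m12"
  assumes f: "holo_embedding f D16 (ball 0 1)" "f 0 = 0" "ball 0 r \<subseteq> f ` D16" and r: "0 < r"
    and L: "(f has_derivative L) (at 0)" and Lc: "\<And>c v. L (c *\<^sub>C v) = c *\<^sub>C L v"
    and k: "spin_map k" "cmod (X (k e)) = 1"
  shows "r \<le> norm (L e)"
proof (rule ccontr)
  assume less: "\<not> r \<le> norm (L e)"
  obtain g where g: "holo_on g (f ` D16)" "\<forall>x\<in>D16. g (f x) = x"
    using f(1) unfolding holo_embedding_def by blast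
  have f0: "0 \<in> f ` D16"
    using zero_in_D16 f(2) by force
  obtain g' where g': "(g has_derivative g') (at 0)" "\<forall>c v. g' (c *\<^sub>C v) = c *\<^sub>C g' v"
    using g(1) f0 unfolding holo_on_def by blast
  have "((\<lambda>x. g (f x)) has_derivative (\<lambda>v. g' (L v))) (at 0)"
    using g'(1) f(2) by (intro has_derivative_compose[OF L]) simp
  then have "((\<lambda>x. x) has_derivative (\<lambda>v. g' (L v))) (at 0)"
    by (rule has_derivative_transform_within_open[OF _ open_D16 zero_in_D16]) (use g(2) in simp)
  then have "(\<lambda>v. g' (L v)) = (\<lambda>v. v)"
    by (rule has_derivative_unique[OF _ has_derivative_ident])
  then have gL: "g' (L v) = v" for v
    by (rule fun_cong)
  have lin: "linear g'"
    using g'(1) has_derivative_linear by blast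
  have Xk: "linear (\<lambda>z. X (k z))" "X (k (c *\<^sub>C z)) = c * X (k z)" for c z
    using linear_compose[OF spin_mapD(1)[OF k(1)] X_linear] by (simp_all add: o_def spin_mapD[OF k(1)])
  have holoXk: "holo_on (\<lambda>z. X (k z)) UNIV"
    by (rule holo_on_linear[OF Xk(1)]) (simp add: Xk(2) scaleC_complex_def)
  have "L e \<noteq> 0"
  proof
    assume "L e = 0"
    then have "e = 0"
      using gL[of e] linear_0[OF lin] by simp
    with k(2) spin_mapD(1)[OF k(1)] show False
      by (simp add: linear_0)
  qed
  then have y: "0 < norm (L e)"
    by simp
  define s where "s = r / norm (L e)"
  have s: "1 < s"
    using less y by (simp add: s_def)
  have "cmod (X (k (g' (s *\<^sub>R L e)))) \<le> 1"
  proof (rule Schwarz_directional[where h = "\<lambda>w. X (k (g w))" and L = "\<lambda>w. X (k (g' w))" and D = "ball 0 r"])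
    show "holo_on (\<lambda>w. X (k (g w))) (ball 0 r)"
      by (rule holo_on_compose[OF holo_on_subset[OF g(1) f(3)] holoXk subset_UNIV])
    show "X (k (g 0)) = 0"
      using g(2) zero_in_D16 f(2) spin_mapD(1)[OF k(1)] by (metis coord_zero(1) linear_0)
    show "cmod (X (k (g w))) < 1" if "w \<in> ball 0 r" for w
    proof -
      have "g w \<in> D16"
        using f(3) g(2) that by auto
      then show ?thesis
        using D16_X spin_map_D16[OF k(1)] by blast
    qed
    show "((\<lambda>w. X (k (g w))) has_derivative (\<lambda>w. X (k (g' w)))) (at 0)"
      using Xk(1) by (intro has_derivative_compose[OF g'(1)] bounded_linear_imp_has_derivative)
        (simp add: linear_conv_bounded_linear)
    show "c *\<^sub>C s *\<^sub>R L e \<in> ball 0 r" if "cmod c < 1" for c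
      using that r y by (simp add: norm_scaleC s_def)
  qed
  also have "X (k (g' (s *\<^sub>R L e))) = s * X (k e)"
    using gL[of e] Xk(2)[of "of_real s" e] by (simp add: linear_scale[OF lin] scaleC_of_real)
  finally show False
    using s k(2) by (simp add: norm_mult)
qed

lemma squeezing_D16_0_le: "squeezing D16 0 \<le> 1 / sqrt 2"
  unfolding squeezing_alt
proof (rule cSup_least)
  show "squeezing_radii D16 0 \<noteq> {}"
    using squeezing_radii_near_0[of 0] zero_in_D16 by auto
  fix r assume "r \<in> squeezing_radii D16 0"
  then obtain f :: "m12 \<Rightarrow> m12" where r: "0 < r"
    and f: "holo_embedding f D16 (ball 0 1)" "f 0 = 0" "ball 0 r \<subseteq> f ` D16"
    by (auto simp: squeezing_radii_def)
  have fD: "holo_on f D16" "f ` D16 \<subseteq> ball 0 1"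
    using f(1) by (simp_all add: holo_embedding_def)
  obtain L where L: "(f has_derivative L) (at 0)" and Lc: "\<forall>c v. L (c *\<^sub>C v) = c *\<^sub>C L v"
    using fD(1) zero_in_D16 unfolding holo_on_def by blast
  define w where "w = (\<lambda>i::5. if i = 2 then 1 else 0 :: complex)"
  define e1 e2 where "e1 = of_coords 1 (\<lambda>_. 0) (\<lambda>_. 0) (\<lambda>_. 0)" and "e2 = of_coords 0 (\<lambda>_. 0) (\<lambda>_. 0) w"
  have fr: "frame e1 e2"
    unfolding e1_def e2_def by (rule frame_standard) (simp_all add: w_def sum_5)
  have "r \<le> norm (L e1)"
    by (rule squeezing_radius_le[OF f r L _ spin_map_id]) (simp_all add: Lc e1_def)
  moreover have "r \<le> norm (L e2)"
  proof (rule squeezing_radius_le[OF f r L])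
    \<comment> \<open>Two quarter rotations carry the entry \<open>2\<close> of \<open>W\<close> first into the matrix and then to \<open>X\<close>.\<close>
    show "spin_map (\<lambda>z. root_rotation 0 1 (cyclic_shift 3 (root_rotation 0 1 z)))"
      by (rule spin_map_compose[OF spin_map_root_rotation spin_map_compose[OF spin_map_cyclic_shift spin_map_root_rotation]]) simp_all
    show "cmod (X (root_rotation 0 1 (cyclic_shift 3 (root_rotation 0 1 e2)))) = 1"
      by (simp add: root_rotation_def cyclic_shift_def e2_def w_def)
  qed (simp add: Lc)
  ultimately have "2 * r\<^sup>2 \<le> (norm (L e1))\<^sup>2 + (norm (L e2))\<^sup>2"
    using r power_mono[of r "norm (L e1)" 2] power_mono[of r "norm (L e2)" 2] by linarith
  moreover have "norm (L (e1 + t *\<^sub>C e2)) \<le> 1" if "cmod t = 1" for t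
    by (rule Schwarz_directional_ball[OF fD(1) f(2) fD(2) L D16_frame_disc[OF fr that]])
  from this[of 1] this[of "- 1"] have "norm (L e1 + L e2) \<le> 1" "norm (L e1 - L e2) \<le> 1"
    using has_derivative_linear[OF L] scaleC_of_real[of 1 e2] scaleC_of_real[of "- 1" e2]
    by (simp_all add: linear_add linear_diff linear_neg)
  then have "(norm (L e1 + L e2))\<^sup>2 \<le> 1" "(norm (L e1 - L e2))\<^sup>2 \<le> 1"
    by (simp_all add: power_le_one)
  moreover have "(norm (L e1 + L e2))\<^sup>2 + (norm (L e1 - L e2))\<^sup>2 = 2 * ((norm (L e1))\<^sup>2 + (norm (L e2))\<^sup>2)"
    by (simp add: power2_norm_eq_inner inner_simps inner_commute)
  ultimately have "r\<^sup>2 \<le> 1 / 2"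
    by simp
  then have "r \<le> sqrt (1 / 2)"
    by (rule real_le_rsqrt)
  then show "r \<le> 1 / sqrt 2"
    by (simp add: real_sqrt_divide)
qed

theorem proposition4p3: "squeezing_constant D16 = 1 / sqrt 2"
  unfolding squeezing_constant_def
proof (rule antisym)
  have "bdd_below (squeezing D16 ` D16)"
    using squeezing_D16_ge by (rule bdd_belowI2)
  then have "(INF p\<in>D16. squeezing D16 p) \<le> squeezing D16 0"
    using zero_in_D16 by (rule cINF_lower)
  then show "(INF p\<in>D16. squeezing D16 p) \<le> 1 / sqrt 2"
    using squeezing_D16_0_le by (rule order_trans)
  show "1 / sqrt 2 \<le> (INF p\<in>D16. squeezing D16 p)"
    using squeezing_D16_ge zero_in_D16 by (intro cINF_greatest) auto
qed

end
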